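(* Let $G$ and $H$ be locally compact groups, let $\pi:G\to\mathcal{U}(\mathcal{H}_{\pi})$ and $\rho:H\to\mathcal{U}(\mathcal{H}_{\rho})$ be two square integrable representations, and let $g\in\mathcal{H}_{\pi}$ and $h\in\mathcal{H}_{\rho}$ be admissible vectors. There is an isomorphism of reproducing kernel Hilbert spaces $$\mathcal{W}_{g\otimes h}(\mathcal{H}_{\pi}\hat{\otimes}\mathcal{H}_{\rho})\simeq\mathcal{W}_{g}(\mathcal{H}_{\pi})\hat{\otimes}\mathcal{W}_{h}(\mathcal{H}_{\rho}),$$ where the left-hand side is the wavelet space of the tensor product representation $\pi\otimes\rho$ of $G\times H$ with respect to the vector $g\otimes h$.
   Context: Locally compact groups are Hausdorff, $L^2$-spaces are taken with respect to fixed left Haar measures (on $G\times H$ the product of those on $G$ and $H$), and inner products are linear in the first argument. A unitary representation $\pi:G\to\mathcal{U}(\mathcal{H}_{\pi})$ is a group homomorphism into the unitary operators of a Hilbert space such that for all $f,g\in\mathcal{H}_\pi$ the function (wavelet transform) $\mathcal{W}_{g}f(x):=\langle f,\pi(x)g\rangle_{\mathcal{H}_\pi}$ is continuous on $G$. It is irreducible if its only closed invariant subspaces are $\{0\}$ and $\mathcal{H}_\pi$. A square integrable representation is an irreducible unitary representation $\pi$ for which there is a non-zero $g\in\mathcal{H}_\pi$ with $\mathcal{W}_g g\in L^2(G)$; such a $g$ is called a square integrable vector. By the Duflo-Moore theorem there is a unique positive, densely defined, injective operator $C_\pi$ on $\mathcal{H}_\pi$, whose domain consists of $0$ and the square integrable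 vectors, with $\langle\mathcal{W}_{g_1}f_1,\mathcal{W}_{g_2}f_2\rangle_{L^2(G)}=\langle f_1,f_2\rangle\,\overline{\langle C_\pi g_1,C_\pi g_2\rangle}$ for all $f_1,f_2\in\mathcal{H}_\pi$ and $g_1,g_2\in\mathrm{dom}(C_\pi)$. A square integrable vector $g$ is admissible if $\|C_\pi g\|=1$; equivalently, $\mathcal{W}_g:\mathcal{H}_\pi\to L^2(G)$ is an isometry. For $g$ admissible, the wavelet space is $\mathcal{W}_g(\mathcal{H}_\pi):=\{\mathcal{W}_g f: f\in\mathcal{H}_\pi\}\subset L^2(G)$ with the $L^2(G)$-norm. A reproducing kernel Hilbert space on a set $X$ is a Hilbert space of functions $X\to\mathbb{C}$ on which every evaluation $E_x(f)=f(x)$ is bounded; with $k_x$ the element satisfying $f(x)=\langle f,k_x\rangle$, its reproducing kernel is $K(x,y)=\langle k_y,k_x\rangle$, and it determines the space and its norm uniquely. The wavelet space $\mathcal{W}_g(\mathcal{H}_\pi)$ is a reproducing kernel Hilbert space on $G$ with kernel $K(x,y)=\langle\pi(y)g,\pi(x)g\rangle$. $\hat{\otimes}$ is the completed Hilbert space tensor product. If $\mathcal{H}_i$ is a reproducing kernel Hilbert space on $X_i$ with kernel $K_i$ ($i=1,2$), then $\mathcal{H}_1\hat{\otimes}\mathcal{H}_2$ is identified, via the isometric extension of $\sum_i f_i\otimes g_i\mapsto\big((x,y)\mapsto\sum_i f_i(x)g_i(y)\big)$, with the reproducing kernel Hilbert space on $X_1\times X_2$ with kernel $K((x_1,y_1),(x_2,y_2))=K_1(x_1,x_2)K_2(y_1,y_2)$.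 The tensor product representation $\pi\otimes\rho:G\times H\to\mathcal{U}(\mathcal{H}_\pi\hat{\otimes}\mathcal{H}_\rho)$ is determined by $(\pi\otimes\rho)(x,y)(f_1\otimes f_2)=\pi(x)f_1\otimes\rho(y)f_2$. An isomorphism of reproducing kernel Hilbert spaces on the same set is a Hilbert space isomorphism preserving the reproducing kernels; when $\mathcal{W}_{g}(\mathcal{H}_{\pi})\hat{\otimes}\mathcal{W}_{h}(\mathcal{H}_{\rho})$ is identified, via the isometric extension of $\sum_i F_i\otimes F_i'\mapsto\big((x,y)\mapsto\sum_i F_i(x)F_i'(y)\big)$ with $F_i\in\mathcal{W}_{g}(\mathcal{H}_{\pi})$ and $F_i'\in\mathcal{W}_{h}(\mathcal{H}_{\rho})$, with the reproducing kernel Hilbert space on $G\times H$ whose kernel is the product of the kernels of $\mathcal{W}_{g}(\mathcal{H}_{\pi})$ and $\mathcal{W}_{h}(\mathcal{H}_{\rho})$, this means that the two spaces are the same space of functions on $G\times H$ with equal norms and equal reproducing kernels. *)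

theory Defs
  imports "HOL-Analysis.Analysis"
begin

section \<open>Complex Hilbert spaces\<close>

text \<open>The inner product is linear in the first argument.\<close>

class complex_hilbert = banach +
  fixes scaleC :: "complex \<Rightarrow> 'a \<Rightarrow> 'a"
    and cinner :: "'a \<Rightarrow> 'a \<Rightarrow> complex"
  assumes scaleC_add_right: "scaleC a (x + y) = scaleC a x + scaleC a y"
    and scaleC_add_left: "scaleC (a + b) x = scaleC a x + scaleC b x"
    and scaleC_scaleC: "scaleC a (scaleC b x) = scaleC (a * b) x"
    and scaleC_of_real: "scaleC (complex_of_real r) x = r *\<^sub>R x"
    and cinner_commute: "cinner x y = cnj (cinner y x)"
    and cinner_add_left: "cinner (x + y) z = cinner x z + cinner y z"
    and cinner_scaleC_left: "cinner (scaleC a x) y = a * cinner x y"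
    and cinner_self: "cinner x x = complex_of_real ((norm x)\<^sup>2)"

definition complex_subspace :: "'h::complex_hilbert set \<Rightarrow> bool" where
  "complex_subspace S \<longleftrightarrow> subspace S \<and> (\<forall>c. \<forall>x\<in>S. scaleC c x \<in> S)"

definition complex_linear_on :: "'h::complex_hilbert set \<Rightarrow> ('h \<Rightarrow> 'k::complex_hilbert) \<Rightarrow> bool" where
  "complex_linear_on S T \<longleftrightarrow>
     (\<forall>x\<in>S. \<forall>y\<in>S. T (x + y) = T x + T y) \<and> (\<forall>c. \<forall>x\<in>S. T (scaleC c x) = scaleC c (T x))"

definition unitary_op :: "('h::complex_hilbert \<Rightarrow> 'h) \<Rightarrow> bool" where
  "unitary_op U \<longleftrightarrow>
     complex_linear_on UNIV U \<and> surj U \<and> (\<forall>x y. cinner (U x) (U y) = cinner x y)"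

text \<open>
  The completed tensor product is determined up to unitary isomorphism. The predicate says that a
  Hilbert space \<open>'t\<close> with a bilinear map \<open>ten\<close> is a model of it. The set of elementary tensors is
  closed under complex scalars, so its real span is its complex span.
\<close>

definition hilbert_tensor ::
    "('h::complex_hilbert \<Rightarrow> 'k::complex_hilbert \<Rightarrow> 't::complex_hilbert) \<Rightarrow> bool" where
  "hilbert_tensor ten \<longleftrightarrow>
     (\<forall>v. complex_linear_on UNIV (\<lambda>u. ten u v)) \<and>
     (\<forall>u. complex_linear_on UNIV (ten u)) \<and>
     (\<forall>u v u' v'. cinner (ten u v) (ten u' v') = cinner u u' * cinner v v') \<and>
     closure (span {ten u v | u v. True}) = UNIV"

section \<open>Haar measures and square integrable functions\<close>

definition radon_measure :: "'a::t2_space measure \<Rightarrow> bool" where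
  "radon_measure \<mu> \<longleftrightarrow>
     sets \<mu> = sets borel \<and>
     (\<forall>K. compact K \<longrightarrow> emeasure \<mu> K < \<infinity>) \<and>
     (\<forall>A\<in>sets borel. emeasure \<mu> A = (INF U\<in>{U. open U \<and> A \<subseteq> U}. emeasure \<mu> U)) \<and>
     (\<forall>U. open U \<longrightarrow> emeasure \<mu> U = (SUP K\<in>{K. compact K \<and> K \<subseteq> U}. emeasure \<mu> K))"

text \<open>
  Groups are written additively, as in the type class \<^class>\<open>group_add\<close>, but are not assumed to be
  commutative.
\<close>

definition left_haar_measure :: "'a::{topological_group_add,t2_space} measure \<Rightarrow> bool" where
  "left_haar_measure \<mu> \<longleftrightarrow>
     radon_measure \<mu> \<and> emeasure \<mu> UNIV \<noteq> 0 \<and>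
     (\<forall>a. \<forall>A\<in>sets borel. emeasure \<mu> ((\<lambda>x. a + x) ` A) = emeasure \<mu> A)"

text \<open>
  No countability is assumed, so the Borel sets of a product space may form a larger
  sigma-algebra than the product of the Borel sigma-algebras, and the product of the measures is
  the Radon product. A Radon measure is determined by its values on products of compact sets.
\<close>

definition radon_product_measure ::
    "'a::t2_space measure \<Rightarrow> 'b::t2_space measure \<Rightarrow> ('a \<times> 'b) measure \<Rightarrow> bool" where
  "radon_product_measure \<mu> \<nu> \<kappa> \<longleftrightarrow>
     radon_measure \<kappa> \<and>
     (\<forall>K L. compact K \<longrightarrow> compact L \<longrightarrow> emeasure \<kappa> (K \<times> L) = emeasure \<mu> K * emeasure \<nu> L)"

definition in_L2 :: "'a measure \<Rightarrow> ('a \<Rightarrow> complex) \<Rightarrow> bool" where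
  "in_L2 \<mu> F \<longleftrightarrow> F \<in> borel_measurable \<mu> \<and> integrable \<mu> (\<lambda>x. (cmod (F x))\<^sup>2)"

definition L2_inner :: "'a measure \<Rightarrow> ('a \<Rightarrow> complex) \<Rightarrow> ('a \<Rightarrow> complex) \<Rightarrow> complex" where
  "L2_inner \<mu> F F' = (LINT x|\<mu>. F x * cnj (F' x))"

section \<open>Square integrable representations\<close>

definition wavelet_transform :: "('a \<Rightarrow> 'h::complex_hilbert \<Rightarrow> 'h) \<Rightarrow> 'h \<Rightarrow> 'h \<Rightarrow> 'a \<Rightarrow> complex" where
  "wavelet_transform \<pi> g f = (\<lambda>x. cinner f (\<pi> x g))"

definition unitary_rep ::
    "('a::{topological_space,group_add} \<Rightarrow> 'h::complex_hilbert \<Rightarrow> 'h) \<Rightarrow> bool" where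
  "unitary_rep \<pi> \<longleftrightarrow>
     (\<forall>x. unitary_op (\<pi> x)) \<and> (\<forall>x y. \<pi> (x + y) = \<pi> x \<circ> \<pi> y) \<and>
     (\<forall>f g. continuous_on UNIV (wavelet_transform \<pi> g f))"

definition irreducible_rep :: "('a \<Rightarrow> 'h::complex_hilbert \<Rightarrow> 'h) \<Rightarrow> bool" where
  "irreducible_rep \<pi> \<longleftrightarrow>
     (\<forall>S. complex_subspace S \<and> closed S \<and> (\<forall>x. \<pi> x ` S \<subseteq> S) \<longrightarrow> S = {0} \<or> S = UNIV)"

definition square_integrable_vector ::
    "'a measure \<Rightarrow> ('a \<Rightarrow> 'h::complex_hilbert \<Rightarrow> 'h) \<Rightarrow> 'h \<Rightarrow> bool" where
  "square_integrable_vector \<mu> \<pi> g \<longleftrightarrow> g \<noteq> 0 \<and> in_L2 \<mu> (wavelet_transform \<pi> g g)"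

definition square_integrable_rep ::
    "'a::{topological_space,group_add} measure \<Rightarrow> ('a \<Rightarrow> 'h::complex_hilbert \<Rightarrow> 'h) \<Rightarrow> bool" where
  "square_integrable_rep \<mu> \<pi> \<longleftrightarrow>
     unitary_rep \<pi> \<and> irreducible_rep \<pi> \<and> (\<exists>g. square_integrable_vector \<mu> \<pi> g)"

definition duflo_moore_domain ::
    "'a measure \<Rightarrow> ('a \<Rightarrow> 'h::complex_hilbert \<Rightarrow> 'h) \<Rightarrow> 'h set" where
  "duflo_moore_domain \<mu> \<pi> = insert 0 {g. square_integrable_vector \<mu> \<pi> g}"

text \<open>
  The values of \<open>C\<close> outside its domain are irrelevant. The membership in \<open>L\<^sup>2\<close> is part of the
  orthogonality relations; without it the integrals could be zero by convention.
\<close>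

definition duflo_moore_operator ::
    "'a measure \<Rightarrow> ('a \<Rightarrow> 'h::complex_hilbert \<Rightarrow> 'h) \<Rightarrow> ('h \<Rightarrow> 'h) \<Rightarrow> bool" where
  "duflo_moore_operator \<mu> \<pi> C \<longleftrightarrow>
     (let D = duflo_moore_domain \<mu> \<pi> in
       complex_subspace D \<and> closure D = UNIV \<and>
       complex_linear_on D C \<and> inj_on C D \<and>
       (\<forall>g\<in>D. cinner (C g) g \<in> \<real> \<and> 0 \<le> Re (cinner (C g) g)) \<and>
       (\<forall>f. \<forall>g\<in>D. in_L2 \<mu> (wavelet_transform \<pi> g f)) \<and>
       (\<forall>f1 f2. \<forall>g1\<in>D. \<forall>g2\<in>D.
          L2_inner \<mu> (wavelet_transform \<pi> g1 f1) (wavelet_transform \<pi> g2 f2) =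
          cinner f1 f2 * cnj (cinner (C g1) (C g2))))"

text \<open>
  The choice of \<open>C\<close> does not matter: the orthogonality relations determine the norm of \<open>C g\<close>.
\<close>

definition admissible ::
    "'a measure \<Rightarrow> ('a \<Rightarrow> 'h::complex_hilbert \<Rightarrow> 'h) \<Rightarrow> 'h \<Rightarrow> bool" where
  "admissible \<mu> \<pi> g \<longleftrightarrow>
     square_integrable_vector \<mu> \<pi> g \<and> (\<exists>C. duflo_moore_operator \<mu> \<pi> C \<and> norm (C g) = 1)"

definition tensor_rep ::
    "('h::complex_hilbert \<Rightarrow> 'k::complex_hilbert \<Rightarrow> 't::complex_hilbert) \<Rightarrow>
     ('a \<Rightarrow> 'h \<Rightarrow> 'h) \<Rightarrow> ('b \<Rightarrow> 'k \<Rightarrow> 'k) \<Rightarrow> 'a \<times> 'b \<Rightarrow> 't \<Rightarrow> 't" where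
  "tensor_rep ten \<pi> \<rho> =
     (\<lambda>(x, y). THE T. unitary_op T \<and> (\<forall>u v. T (ten u v) = ten (\<pi> x u) (\<rho> y v)))"

section \<open>Reproducing kernel Hilbert spaces\<close>

text \<open>Vector space operations are pointwise.\<close>

record 'x function_space =
  funs :: "('x \<Rightarrow> complex) set"
  finner :: "('x \<Rightarrow> complex) \<Rightarrow> ('x \<Rightarrow> complex) \<Rightarrow> complex"

definition fnorm :: "'x function_space \<Rightarrow> ('x \<Rightarrow> complex) \<Rightarrow> real" where
  "fnorm A f = sqrt (Re (finner A f f))"

definition function_hilbert_space :: "'x function_space \<Rightarrow> bool" where
  "function_hilbert_space A \<longleftrightarrow>
     (\<lambda>x. 0) \<in> funs A \<and>
     (\<forall>f\<in>funs A. \<forall>g\<in>funs A. (\<lambda>x. f x + g x) \<in> funs A) \<and>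
     (\<forall>c. \<forall>f\<in>funs A. (\<lambda>x. c * f x) \<in> funs A) \<and>
     (\<forall>f\<in>funs A. \<forall>g\<in>funs A. \<forall>h\<in>funs A.
        finner A (\<lambda>x. f x + g x) h = finner A f h + finner A g h) \<and>
     (\<forall>c. \<forall>f\<in>funs A. \<forall>g\<in>funs A. finner A (\<lambda>x. c * f x) g = c * finner A f g) \<and>
     (\<forall>f\<in>funs A. \<forall>g\<in>funs A. finner A f g = cnj (finner A g f)) \<and>
     (\<forall>f\<in>funs A. 0 \<le> Re (finner A f f) \<and> (finner A f f = 0 \<longrightarrow> f = (\<lambda>x. 0))) \<and>
     (\<forall>s. (\<forall>n. s n \<in> funs A) \<and>
          (\<forall>e>0. \<exists>N::nat. \<forall>m\<ge>N. \<forall>n\<ge>N. fnorm A (\<lambda>x. s m x - s n x) < e) \<longrightarrow>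
          (\<exists>f\<in>funs A. (\<lambda>n. fnorm A (\<lambda>x. s n x - f x)) \<longlonglongrightarrow> 0))"

definition rkhs :: "'x function_space \<Rightarrow> bool" where
  "rkhs A \<longleftrightarrow>
     function_hilbert_space A \<and> (\<forall>x. \<exists>B. \<forall>f\<in>funs A. cmod (f x) \<le> B * fnorm A f)"

definition kernel_element :: "'x function_space \<Rightarrow> 'x \<Rightarrow> 'x \<Rightarrow> complex" where
  "kernel_element A x = (THE k. k \<in> funs A \<and> (\<forall>f\<in>funs A. f x = finner A f k))"

definition reproducing_kernel :: "'x function_space \<Rightarrow> 'x \<Rightarrow> 'x \<Rightarrow> complex" where
  "reproducing_kernel A x y = finner A (kernel_element A y) (kernel_element A x)"

definition rkhs_isomorphic :: "'x function_space \<Rightarrow> 'x function_space \<Rightarrow> bool" where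
  "rkhs_isomorphic A B \<longleftrightarrow>
     rkhs A \<and> rkhs B \<and> funs A = funs B \<and>
     (\<forall>f\<in>funs A. \<forall>g\<in>funs A. finner A f g = finner B f g) \<and>
     reproducing_kernel A = reproducing_kernel B"

definition wavelet_space ::
    "'a measure \<Rightarrow> ('a \<Rightarrow> 'h::complex_hilbert \<Rightarrow> 'h) \<Rightarrow> 'h \<Rightarrow> 'a function_space" where
  "wavelet_space \<mu> \<pi> g = \<lparr>funs = range (wavelet_transform \<pi> g), finner = L2_inner \<mu>\<rparr>"

subsection \<open>Tensor products\<close>

text \<open>
  A list \<open>[(f\<^sub>1, g\<^sub>1), \<dots>, (f\<^sub>n, g\<^sub>n)]\<close> stands for the element \<open>f\<^sub>1 \<otimes> g\<^sub>1 + \<dots> + f\<^sub>n \<otimes> g\<^sub>n\<close> of the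
  algebraic tensor product. Elements of the completion are given by Cauchy sequences of such
  elements, and the isometric extension of \<open>f \<otimes> g \<mapsto> ((x, y) \<mapsto> f x * g y)\<close> sends such a sequence to
  its pointwise limit. The tensor product is the image of this extension, with the inner product
  of the completion; it is the space with the product kernel.
\<close>

type_synonym ('x, 'y) alg_tensor = "(('x \<Rightarrow> complex) \<times> ('y \<Rightarrow> complex)) list"

definition alg_tensor_inner ::
    "'x function_space \<Rightarrow> 'y function_space \<Rightarrow> ('x, 'y) alg_tensor \<Rightarrow> ('x, 'y) alg_tensor \<Rightarrow> complex"
  where
  "alg_tensor_inner A B s t =
     (\<Sum>(f, g)\<leftarrow>s. \<Sum>(f', g')\<leftarrow>t. finner A f f' * finner B g g')"

definition alg_tensor_diff ::
    "('x, 'y) alg_tensor \<Rightarrow> ('x, 'y) alg_tensor \<Rightarrow> ('x, 'y) alg_tensor" where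
  "alg_tensor_diff s t = s @ map (\<lambda>(f, g). ((\<lambda>x. - f x), g)) t"

definition alg_tensor_fun :: "('x, 'y) alg_tensor \<Rightarrow> 'x \<times> 'y \<Rightarrow> complex" where
  "alg_tensor_fun s = (\<lambda>(x, y). \<Sum>(f, g)\<leftarrow>s. f x * g y)"

definition represents ::
    "'x function_space \<Rightarrow> 'y function_space \<Rightarrow> (nat \<Rightarrow> ('x, 'y) alg_tensor) \<Rightarrow>
     ('x \<times> 'y \<Rightarrow> complex) \<Rightarrow> bool" where
  "represents A B s F \<longleftrightarrow>
     (\<forall>n. set (s n) \<subseteq> funs A \<times> funs B) \<and>
     (\<forall>e>0. \<exists>N. \<forall>m\<ge>N. \<forall>n\<ge>N.
        sqrt (Re (alg_tensor_inner A B (alg_tensor_diff (s m) (s n)) (alg_tensor_diff (s m) (s n)))) < e) \<and>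
     (\<forall>p. (\<lambda>n. alg_tensor_fun (s n) p) \<longlonglongrightarrow> F p)"

definition rkhs_tensor ::
    "'x function_space \<Rightarrow> 'y function_space \<Rightarrow> ('x \<times> 'y) function_space" where
  "rkhs_tensor A B =
     \<lparr>funs = {F. \<exists>s. represents A B s F},
      finner = (\<lambda>F F'. THE c. \<forall>s t. represents A B s F \<longrightarrow> represents A B t F' \<longrightarrow>
                   (\<lambda>n. alg_tensor_inner A B (s n) (t n)) \<longlonglongrightarrow> c)\<rparr>"

end

theory Submission
  imports Defs
begin

text \<open>
The proposition rests on the identity \<open>W (u \<otimes> v) (x, y) = W\<^sub>g u x * W\<^sub>h v y\<close>, where \<open>W\<close>, \<open>W\<^sub>g\<close> and \<open>W\<^sub>h\<close>
are the wavelet transforms with windows \<open>g \<otimes> h\<close>, \<open>g\<close> and \<open>h\<close>. If the integral of a product function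
is the product of the integrals, then by admissibility of \<open>g\<close> and \<open>h\<close> the functions \<open>W (u \<otimes> v)\<close>
have the same inner products as the vectors \<open>u \<otimes> v\<close>. These are total, so \<open>W\<close> is an isometry
(\<open>isometric_coefficient_map\<close>). Hence its range is a reproducing kernel Hilbert space, whose kernel is
given by the vectors \<open>\<pi> x g \<otimes> \<rho> y h\<close>. The tensor product of the two wavelet spaces is described by
the same vectors: its elements are pointwise limits of Cauchy sequences of sums of products
\<open>W\<^sub>g u x * W\<^sub>h v y\<close>, and these sums are the wavelet transforms of the corresponding sums of tensors
\<open>u \<otimes> v\<close> (\<open>coefficient_space_rkhs_tensor\<close>). A space of functions \<open>p \<mapsto> \<langle>F, k p\<rangle>\<close> with the inner
product of the vectors \<open>F\<close> is determined by the family \<open>k\<close>, so the two spaces coincide.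

Three points need more than this.

The product formula for integrals is not an instance of Fubini's theorem, since Haar measures need
not be sigma-finite and the product is a Radon product. But the Radon product is multiplicative on
open rectangles by inner regularity, and a nonnegative continuous function is an increasing limit
of combinations of indicators of open sets (\<open>nn_integral_radon_product\<close>).

The operators \<open>\<pi> x \<otimes> \<rho> y\<close> have to be constructed on the completed tensor product; this is the
extension of an isometric correspondence between total sets (\<open>isometric_extension\<close>).

The tensor product representation is irreducible. The projection onto an invariant subspace
commutes with both factors, and slicing it yields operators that commute with \<open>\<pi>\<close> or with \<open>\<rho>\<close>.
These are scalars by Schur's lemma, which for square integrable representations is a direct
consequence of the Duflo-Moore orthogonality relations (\<open>Schur_of_admissible\<close>).
\<close>

section \<open>Complex Hilbert spaces\<close>

lemma cinner_add_right: "cinner x (y + z) = cinner x y + cinner x z"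
  by (metis cinner_add_left cinner_commute complex_cnj_add)

lemma cinner_scaleC_right: "cinner x (scaleC a y) = cnj a * cinner x y"
  by (metis cinner_commute cinner_scaleC_left complex_cnj_mult)

lemma cinner_scaleR_left: "cinner (r *\<^sub>R x) y = r *\<^sub>R cinner x y"
  by (metis cinner_scaleC_left scaleC_of_real scaleR_conv_of_real)

lemma cinner_scaleR_right: "cinner x (r *\<^sub>R y) = r *\<^sub>R cinner x y"
  by (metis cinner_scaleC_right complex_cnj_complex_of_real scaleC_of_real scaleR_conv_of_real)

lemma Re_cinner_self: "Re (cinner x x) = (norm x)\<^sup>2"
  by (simp add: cinner_self)

lemma norm_scaleC: "norm (scaleC c x) = cmod c * norm x"
proof -
  have "complex_of_real ((norm (scaleC c x))\<^sup>2) = c * cnj c * complex_of_real ((norm x)\<^sup>2)"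
    by (metis cinner_self cinner_scaleC_left cinner_scaleC_right mult.assoc)
  also have "\<dots> = complex_of_real ((cmod c * norm x)\<^sup>2)"
    by (simp add: complex_norm_square[symmetric] power_mult_distrib)
  finally have "(norm (scaleC c x))\<^sup>2 = (cmod c * norm x)\<^sup>2"
    by (simp only: of_real_eq_iff)
  then show ?thesis by (simp add: power2_eq_iff_nonneg)
qed

lemma scaleC_minus_one: "scaleC (- 1) x = - x"
  using scaleC_of_real[of "-1" x] by simp

lemma bounded_linear_scaleC: "bounded_linear (scaleC c :: 'h::complex_hilbert \<Rightarrow> 'h)"
proof (rule bounded_linear_intro[where K = "cmod c"])
  fix r :: real and x :: 'h
  show "scaleC c (r *\<^sub>R x) = r *\<^sub>R scaleC c x"
    by (metis mult.commute scaleC_of_real scaleC_scaleC)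
qed (auto simp: scaleC_add_right norm_scaleC mult.commute)

lemma norm_add_sq: "(norm (x + y))\<^sup>2 = (norm x)\<^sup>2 + (norm y)\<^sup>2 + 2 * Re (cinner x y)"
proof -
  have "Re (cinner y x) = Re (cinner x y)" by (metis cinner_commute complex_cnj cnj.simps(1))
  then show ?thesis
    by (simp add: Re_cinner_self[symmetric] cinner_add_left cinner_add_right)
qed

text \<open>
Pythagoras' theorem. That the right-hand side is nonnegative is the Cauchy-Schwarz inequality; the
same identity shows below that a nearest point is the foot of a perpendicular.
\<close>

lemma norm_minus_component_sq:
  fixes x y :: "'h::complex_hilbert"
  assumes "y \<noteq> 0"
  shows "(norm (x - scaleC (cinner x y / complex_of_real ((norm y)\<^sup>2)) y))\<^sup>2 =
    (norm x)\<^sup>2 - (cmod (cinner x y))\<^sup>2 / (norm y)\<^sup>2"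
proof -
  define c where "c = - cinner x y / complex_of_real ((norm y)\<^sup>2)"
  have eq: "x - scaleC (cinner x y / complex_of_real ((norm y)\<^sup>2)) y = x + scaleC c y"
    using scaleC_scaleC[of "-1" "- c" y] by (simp add: c_def scaleC_minus_one)
  have "cnj c * cinner x y = - complex_of_real ((cmod (cinner x y))\<^sup>2 / (norm y)\<^sup>2)"
    unfolding of_real_divide complex_norm_square by (simp add: c_def mult.commute)
  then have "Re (cnj c * cinner x y) = - (cmod (cinner x y))\<^sup>2 / (norm y)\<^sup>2"
    by (metis Re_complex_of_real minus_divide_left of_real_minus)
  moreover have "(norm (scaleC c y))\<^sup>2 = (cmod (cinner x y))\<^sup>2 / (norm y)\<^sup>2"
    using assms by (simp add: norm_scaleC c_def norm_divide norm_power power_divide power_mult_distrib)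
      (simp add: power2_eq_square power4_eq_xxxx assms)
  ultimately show ?thesis
    unfolding eq by (simp add: norm_add_sq cinner_scaleC_right)
qed

lemma cinner_Cauchy_Schwarz: "cmod (cinner x y) \<le> norm x * norm (y :: 'h::complex_hilbert)"
proof (cases "y = 0")
  case True
  then show ?thesis using cinner_scaleR_right[of x 0 y] by simp
next
  case False
  have "0 \<le> (norm x)\<^sup>2 - (cmod (cinner x y))\<^sup>2 / (norm y)\<^sup>2"
    unfolding norm_minus_component_sq[OF False, symmetric] by simp
  then have "(cmod (cinner x y))\<^sup>2 \<le> (norm x * norm y)\<^sup>2"
    using False by (simp add: field_simps)
  then show ?thesis by (rule power2_le_imp_le) simp
qed

interpretation cinner: bounded_bilinear cinner
  by standard (auto simp: cinner_add_left cinner_add_right cinner_scaleR_left cinner_scaleR_right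
      intro!: exI[of _ 1] cinner_Cauchy_Schwarz)

lemma cinner_eqI: "x = y" if "\<And>z. cinner x z = cinner y z"
proof -
  have "cinner (x - y) (x - y) = 0" by (simp add: cinner.diff_left that)
  then show ?thesis by (simp add: cinner_self)
qed

lemma parallelogram_law:
  "(norm (x + y))\<^sup>2 + (norm (x - y))\<^sup>2 = 2 * (norm x)\<^sup>2 + 2 * (norm (y :: 'h::complex_hilbert))\<^sup>2"
  using norm_add_sq[of x y] norm_add_sq[of x "- y"] by (simp add: cinner.minus_right)

lemma complex_polarization:
  "a * cnj b = (complex_of_real ((cmod (a + b))\<^sup>2) - complex_of_real ((cmod (a - b))\<^sup>2)
     + \<i> * complex_of_real ((cmod (a + \<i> * b))\<^sup>2) - \<i> * complex_of_real ((cmod (a - \<i> * b))\<^sup>2)) / 4"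
  by (simp add: complex_eq_iff cmod_power2) (simp add: power2_eq_square algebra_simps)

lemma cinner_polarization:
  "cinner x y = (complex_of_real ((norm (x + y))\<^sup>2) - complex_of_real ((norm (x - y))\<^sup>2)
     + \<i> * complex_of_real ((norm (x + scaleC \<i> y))\<^sup>2)
     - \<i> * complex_of_real ((norm (x - scaleC \<i> y))\<^sup>2)) / 4"
  unfolding cinner_self[symmetric]
  by (simp add: cinner.add_left cinner.add_right cinner.diff_left
      cinner.diff_right cinner_scaleC_left cinner_scaleC_right algebra_simps)

lemma closed_subspace_eq_UNIV:
  assumes "closure (span E) = UNIV" "E \<subseteq> V" "subspace V" "closed V"
  shows "V = UNIV"
  using assms closure_minimal[of "span E" V] span_minimal[of E V] by auto

text \<open>
The usual argument: by the parallelogram law a sequence in \<open>S\<close> whose distance to \<open>x\<close> tends to the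
infimum is Cauchy, and at the limit a nonzero inner product \<open>cinner (x - p) y\<close> would allow the
distance to be decreased further along \<open>y\<close>.
\<close>

lemma projection_exists:
  fixes S :: "'h::complex_hilbert set"
  assumes S: "complex_subspace S" "closed S"
  obtains p where "p \<in> S" "\<And>y. y \<in> S \<Longrightarrow> cinner (x - p) y = 0"
proof -
  have sub: "subspace S" and sc: "\<And>c y. y \<in> S \<Longrightarrow> scaleC c y \<in> S"
    using S(1) by (auto simp: complex_subspace_def)
  define d where "d = infdist x S"
  have ne: "S \<noteq> {}" using sub subspace_0 by blast
  have d_le: "d \<le> norm (x - y)" if "y \<in> S" for y
    using infdist_le[OF that, of x] by (simp add: d_def dist_norm)
  have d0: "0 \<le> d" by (simp add: d_def infdist_nonneg)
  have "\<exists>y\<in>S. norm (x - y) < d + 1 / Suc n" for n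
  proof (rule ccontr)
    assume "\<not> ?thesis"
    then have "d + 1 / Suc n \<le> infdist x S"
      using ne by (auto simp: infdist_def dist_norm not_less intro!: cINF_greatest)
    then show False by (simp add: d_def)
  qed
  then obtain s where s: "\<And>n. s n \<in> S" "\<And>n. norm (x - s n) < d + 1 / Suc n" by metis
  have lim: "(\<lambda>n. norm (x - s n)) \<longlonglongrightarrow> d"
  proof (rule tendsto_sandwich[of "\<lambda>_. d" _ _ "\<lambda>n. d + 1 / Suc n"])
    show "(\<lambda>n. d + 1 / real (Suc n)) \<longlonglongrightarrow> d"
      using tendsto_add[OF tendsto_const[of d] LIMSEQ_inverse_real_of_nat]
      by (simp add: inverse_eq_divide)
  qed (use d_le s in \<open>auto intro!: always_eventually less_imp_le simp del: of_nat_Suc\<close>)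
  have mid: "(norm (s m - s n))\<^sup>2 \<le> 2 * ((norm (x - s m))\<^sup>2 - d\<^sup>2) + 2 * ((norm (x - s n))\<^sup>2 - d\<^sup>2)" for m n
  proof -
    have "(1 / 2) *\<^sub>R (s m + s n) \<in> S" using s(1) sub by (simp add: subspace_add subspace_scale)
    then have "d \<le> norm (x - (1 / 2) *\<^sub>R (s m + s n))" by (rule d_le)
    then have "d\<^sup>2 \<le> (norm (x - (1 / 2) *\<^sub>R (s m + s n)))\<^sup>2" using d0 by (simp add: power_mono)
    also have "\<dots> = (norm ((1 / 2) *\<^sub>R ((x - s m) + (x - s n))))\<^sup>2"
      by (intro arg_cong[where f = "\<lambda>z. (norm z)\<^sup>2"])
         (simp add: algebra_simps flip: scaleR_add_left)
    finally have "4 * d\<^sup>2 \<le> (norm ((x - s m) + (x - s n)))\<^sup>2"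
      by (simp add: power_mult_distrib power_divide)
    then show ?thesis using parallelogram_law[of "x - s m" "x - s n"]
      by (simp add: norm_minus_commute)
  qed
  have "Cauchy s"
  proof (rule CauchyI)
    fix e :: real assume e: "0 < e"
    have "(\<lambda>n. (norm (x - s n))\<^sup>2) \<longlonglongrightarrow> d\<^sup>2" by (intro tendsto_intros lim)
    then have "eventually (\<lambda>n. (norm (x - s n))\<^sup>2 < d\<^sup>2 + e\<^sup>2 / 4) sequentially"
      using e by (intro order_tendstoD) auto
    then obtain N where N: "\<And>n. n \<ge> N \<Longrightarrow> (norm (x - s n))\<^sup>2 < d\<^sup>2 + e\<^sup>2 / 4"
      by (auto simp: eventually_sequentially)
    have "norm (s m - s n) < e" if "m \<ge> N" "n \<ge> N" for m n
    proof (rule power2_less_imp_less)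
      show "(norm (s m - s n))\<^sup>2 < e\<^sup>2" using mid[of m n] N[OF that(1)] N[OF that(2)] by simp
    qed (use e in simp)
    then show "\<exists>M. \<forall>m\<ge>M. \<forall>n\<ge>M. norm (s m - s n) < e" by blast
  qed
  then obtain p where p: "s \<longlonglongrightarrow> p" by (auto simp: Cauchy_convergent_iff convergent_def)
  have pS: "p \<in> S" using S(2) s(1) p closed_sequentially by blast
  have "(\<lambda>n. norm (x - s n)) \<longlonglongrightarrow> norm (x - p)" by (intro tendsto_intros p)
  then have np: "norm (x - p) = d" using lim LIMSEQ_unique by blast
  have "cinner (x - p) y = 0" if y: "y \<in> S" for y
  proof (cases "y = 0")
    case False
    define c where "c = cinner (x - p) y / complex_of_real ((norm y)\<^sup>2)"
    have "p + scaleC c y \<in> S" using pS y sub sc by (simp add: subspace_add)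
    then have "d \<le> norm (x - (p + scaleC c y))" by (rule d_le)
    then have "(norm (x - p))\<^sup>2 \<le> (norm ((x - p) - scaleC c y))\<^sup>2"
      using d0 np by (simp add: power_mono diff_diff_add)
    also have "\<dots> = (norm (x - p))\<^sup>2 - (cmod (cinner (x - p) y))\<^sup>2 / (norm y)\<^sup>2"
      unfolding c_def by (rule norm_minus_component_sq[OF False])
    finally have "(cmod (cinner (x - p) y))\<^sup>2 / (norm y)\<^sup>2 \<le> 0" by simp
    then show ?thesis using False by (simp add: divide_le_0_iff)
  qed (simp add: cinner.zero_right)
  with pS that show ?thesis by blast
qed

text \<open>
The representing vector is a multiple of a vector \<open>z\<close> orthogonal to the kernel of \<open>f\<close>, since the
kernel and \<open>z\<close> together span the space.
\<close>

lemma Riesz_representation: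
  fixes f :: "'h::complex_hilbert \<Rightarrow> complex"
  assumes add: "\<And>x y. f (x + y) = f x + f y"
    and sc: "\<And>c x. f (scaleC c x) = c * f x"
    and bd: "\<And>x. cmod (f x) \<le> norm x * B"
  obtains z where "\<And>x. f x = cinner x z"
proof (cases "\<forall>x. f x = 0")
  case True
  then show ?thesis by (intro that[of 0]) (simp add: cinner.zero_right)
next
  case False
  then obtain a where a: "f a \<noteq> 0" by blast
  have bl: "bounded_linear f"
    using add sc[of "complex_of_real _"] bd
    by (intro bounded_linear_intro[where K = B]) (auto simp: scaleC_of_real scaleR_conv_of_real)
  interpret f: bounded_linear f by (rule bl)
  define N where "N = {x. f x = 0}"
  have "complex_subspace N"
    using sc by (auto simp: complex_subspace_def subspace_def N_def add f.scaleR f.zero)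
  moreover have "closed N"
    unfolding N_def by (intro closed_Collect_eq continuous_intros linear_continuous_on bl)
  ultimately obtain p where p: "p \<in> N" "\<And>y. y \<in> N \<Longrightarrow> cinner (a - p) y = 0"
    using projection_exists[of N a] by blast
  define z where "z = a - p"
  have fz: "f z = f a" using p(1) by (simp add: z_def N_def f.diff)
  have z0: "z \<noteq> 0" using fz a f.zero by auto
  have "f x = cinner x (scaleC (cnj (f z) / complex_of_real ((norm z)\<^sup>2)) z)" for x
  proof -
    have "x - scaleC (f x / f z) z \<in> N" using a fz by (simp add: N_def f.diff sc)
    then have "cinner (x - scaleC (f x / f z) z) z = 0"
      using p(2) z_def cinner_commute[of _ z] by (metis complex_cnj_zero)
    then have "cinner x z = f x / f z * complex_of_real ((norm z)\<^sup>2)"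
      by (simp add: cinner.diff_left cinner_scaleC_left cinner_self)
    then show ?thesis using z0 a fz by (simp add: cinner_scaleC_right)
  qed
  then show ?thesis using that by blast
qed

section \<open>Unitary operators on a tensor product\<close>

lemma subspace_closure:
  fixes S :: "'v::real_normed_vector set"
  assumes "subspace S"
  shows "subspace (closure S)"
proof (rule subspaceI)
  show "0 \<in> closure S" using assms subspace_0 closure_subset by blast
  show "x + y \<in> closure S" if "x \<in> closure S" "y \<in> closure S" for x y
  proof -
    obtain f g where "\<forall>n. f n \<in> S" "f \<longlonglongrightarrow> x" "\<forall>n. g n \<in> S" "g \<longlonglongrightarrow> y"
      using \<open>x \<in> closure S\<close> \<open>y \<in> closure S\<close> unfolding closure_sequential by metis
    then show ?thesis unfolding closure_sequential
      by (intro exI[of _ "\<lambda>n. f n + g n"]) (auto intro!: tendsto_intros subspace_add assms)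
  qed
  show "r *\<^sub>R x \<in> closure S" if "x \<in> closure S" for r x
  proof -
    obtain f where "\<forall>n. f n \<in> S" "f \<longlonglongrightarrow> x"
      using \<open>x \<in> closure S\<close> unfolding closure_sequential by metis
    then show ?thesis unfolding closure_sequential
      by (intro exI[of _ "\<lambda>n. r *\<^sub>R f n"]) (auto intro!: tendsto_intros subspace_scale assms)
  qed
qed

text \<open>
The unitary map is obtained from its graph, the closed span \<open>R\<close> of \<open>\<Gamma>\<close> in the product space. This
avoids choosing representations of a vector as a linear combination: the inner products agree on
all of \<open>R\<close> by linearity and continuity, hence both projections are isometric up to the factor
\<open>sqrt 2\<close> and have closed range. Their ranges contain total sets, so \<open>R\<close> is the graph of a bijection.
\<close>

lemma isometric_extension:
  fixes \<Gamma> :: "('s::complex_hilbert \<times> 't::complex_hilbert) set"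
  assumes inner: "\<And>x x' y y'. (x, x') \<in> \<Gamma> \<Longrightarrow> (y, y') \<in> \<Gamma> \<Longrightarrow> cinner x' y' = cinner x y"
    and sc: "\<And>c x x'. (x, x') \<in> \<Gamma> \<Longrightarrow> (scaleC c x, scaleC c x') \<in> \<Gamma>"
    and dense_fst: "closure (span (fst ` \<Gamma>)) = UNIV"
    and dense_snd: "closure (span (snd ` \<Gamma>)) = UNIV"
  obtains T where "complex_linear_on UNIV T" "surj T" "\<And>x y. cinner (T x) (T y) = cinner x y"
    "\<And>x x'. (x, x') \<in> \<Gamma> \<Longrightarrow> T x = x'"
proof -
  define R where "R = closure (span \<Gamma>)"
  have subR: "subspace R" unfolding R_def by (intro subspace_closure subspace_span)
  have clR: "closed R" by (simp add: R_def)
  have subset: "R \<subseteq> V" if "\<Gamma> \<subseteq> V" "subspace V" "closed V" for V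
    unfolding R_def using that by (intro closure_minimal span_minimal)
  have \<Gamma>R: "\<Gamma> \<subseteq> R" unfolding R_def using span_superset closure_subset by blast
  have *: "R \<subseteq> {p. cinner (snd p) (snd q) = cinner (fst p) (fst q)}" if "q \<in> \<Gamma>" for q
    by (intro subset)
       (use that inner in \<open>force simp: subspace_def cinner.zero_left cinner.add_left cinner.scaleR_left
         intro!: closed_Collect_eq continuous_intros cinner.continuous_on\<close>)+
  have "R \<subseteq> {q. cinner (snd p) (snd q) = cinner (fst p) (fst q)}" if "p \<in> R" for p
    by (intro subset)
       (use that * in \<open>force simp: subspace_def cinner.zero_right cinner.add_right cinner.scaleR_right
         intro!: closed_Collect_eq continuous_intros cinner.continuous_on\<close>)+
  then have innerR: "cinner x' y' = cinner x y" if "(x, x') \<in> R" "(y, y') \<in> R" for x x' y y'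
    using that by fastforce
  have normR: "norm (snd p) = norm (fst p)" if "p \<in> R" for p
  proof -
    have "(norm (snd p))\<^sup>2 = (norm (fst p))\<^sup>2"
      using innerR[of "fst p" "snd p" "fst p" "snd p"] that by (simp add: Re_cinner_self[symmetric])
    then show ?thesis by (simp add: power2_eq_iff_nonneg)
  qed
  have norm_pair: "norm p = sqrt 2 * norm (fst p)" if "p \<in> R" for p
    using normR[OF that] by (cases p) (simp add: norm_Pair real_sqrt_mult flip: mult_2)
  have complR: "complete R" using clR by (simp add: complete_eq_closed)
  have "complete (fst ` R)"
    by (rule complete_isometric_image[of "1 / sqrt 2"])
       (auto simp: subR bounded_linear_fst complR norm_pair)
  moreover have "complete (snd ` R)"
    by (rule complete_isometric_image[of "1 / sqrt 2"])
       (auto simp: subR bounded_linear_snd complR norm_pair dest: normR)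
  moreover have "subspace (fst ` R)" "subspace (snd ` R)"
    by (auto intro!: linear_subspace_image subR bounded_linear.linear bounded_linear_fst bounded_linear_snd)
  ultimately have onto: "fst ` R = UNIV" "snd ` R = UNIV"
    using closed_subspace_eq_UNIV[OF dense_fst] closed_subspace_eq_UNIV[OF dense_snd] \<Gamma>R
    by (simp_all add: complete_imp_closed image_mono)
  have "\<exists>x'. (x, x') \<in> R" for x using onto(1) by (metis UNIV_I imageE prod.collapse)
  then obtain T where T: "\<And>x. (x, T x) \<in> R" by metis
  have uniq: "x' = T x" if "(x, x') \<in> R" for x x'
    using normR[OF subspace_diff[OF subR that T[of x]]] by simp
  have scR: "(scaleC c x, scaleC c x') \<in> R" if "(x, x') \<in> R" for c x x'
  proof -
    have bl: "bounded_linear (\<lambda>p :: 's \<times> 't. (scaleC c (fst p), scaleC c (snd p)))"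
      by (intro bounded_linear_Pair bounded_linear_compose[OF bounded_linear_scaleC]
          bounded_linear_fst bounded_linear_snd)
    have "R \<subseteq> (\<lambda>p. (scaleC c (fst p), scaleC c (snd p))) -` R"
    proof (rule subset)
      show "\<Gamma> \<subseteq> (\<lambda>p. (scaleC c (fst p), scaleC c (snd p))) -` R"
        using sc[of _ _ c] \<Gamma>R by (auto simp: subset_iff)
      show "subspace ((\<lambda>p :: 's \<times> 't. (scaleC c (fst p), scaleC c (snd p))) -` R)"
        using bl subR by (intro linear_subspace_vimage bounded_linear.linear)
      show "closed ((\<lambda>p :: 's \<times> 't. (scaleC c (fst p), scaleC c (snd p))) -` R)"
        using bl clR by (intro closed_vimage linear_continuous_on)
    qed
    with that show ?thesis by (simp add: subset_iff)
  qed
  show ?thesis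
  proof (rule that[of T])
    show "complex_linear_on UNIV T"
      using subspace_add[OF subR T T] scR[OF T] uniq by (auto simp: complex_linear_on_def) metis+
    show "surj T" using onto(2) uniq by (metis UNIV_I imageE prod.collapse surj_def)
    show "cinner (T x) (T y) = cinner x y" for x y by (rule innerR[OF T T])
    show "T x = x'" if "(x, x') \<in> \<Gamma>" for x x' using uniq \<Gamma>R that by blast
  qed
qed

lemma unitary_op_bij: "bij U" if "unitary_op U"
proof -
  have "inj U"
  proof (rule injI)
    fix x y assume eq: "U x = U y"
    have "cinner x z = cinner y z" for z using that eq by (metis unitary_op_def)
    then show "x = y" by (rule cinner_eqI)
  qed
  then show ?thesis using that by (simp add: bij_def unitary_op_def)
qed

lemma unitary_op_norm: "norm (U x) = norm x" if "unitary_op U"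
proof -
  have "(norm (U x))\<^sup>2 = (norm x)\<^sup>2"
    using that by (simp add: unitary_op_def Re_cinner_self[symmetric])
  then show ?thesis by (simp add: power2_eq_iff_nonneg)
qed

lemma unitary_op_bounded_linear: "bounded_linear U" if "unitary_op U"
  using that unitary_op_norm[OF that]
  by (intro bounded_linear_intro[where K = 1])
     (auto simp: unitary_op_def complex_linear_on_def simp flip: scaleC_of_real)

locale tensor_model =
  fixes ten :: "'h::complex_hilbert \<Rightarrow> 'k::complex_hilbert \<Rightarrow> 't::complex_hilbert"
  assumes hilbert_tensor: "hilbert_tensor ten"
begin

lemma ten_add_left: "ten (u + u') v = ten u v + ten u' v"
  and ten_scaleC_left: "ten (scaleC c u) v = scaleC c (ten u v)"
  and cinner_ten: "cinner (ten u v) (ten u' v') = cinner u u' * cinner v v'"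
  using hilbert_tensor by (auto simp: hilbert_tensor_def complex_linear_on_def)

definition elementary :: "'t set" where
  "elementary = {ten u v | u v. True}"

lemma elementary_dense: "closure (span elementary) = UNIV"
  using hilbert_tensor by (auto simp: hilbert_tensor_def elementary_def)

lemma norm_ten: "norm (ten u v) = norm u * norm v"
proof -
  have "complex_of_real ((norm (ten u v))\<^sup>2) = complex_of_real ((norm u * norm v)\<^sup>2)"
    unfolding cinner_self[symmetric] cinner_ten by (simp add: cinner_self power_mult_distrib)
  then show ?thesis by (simp only: of_real_eq_iff power2_eq_iff_nonneg norm_ge_zero mult_nonneg_nonneg)
qed

lemma eq_UNIV:
  "V = UNIV" if "\<And>u v. ten u v \<in> V" "subspace V" "closed V"
  using that by (intro closed_subspace_eq_UNIV[OF elementary_dense]) (auto simp: elementary_def)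

lemma cinner_eqI_ten: "x = y" if "\<And>u v. cinner x (ten u v) = cinner y (ten u v)"
proof (rule cinner_eqI)
  have "{z. cinner x z = cinner y z} = UNIV"
    by (intro eq_UNIV) (use that in \<open>auto simp: subspace_def cinner.zero_right cinner.add_right
       cinner.scaleR_right intro!: closed_Collect_eq cinner.continuous_on continuous_intros\<close>)
  then show "cinner x z = cinner y z" for z by auto
qed

lemma tensor_operator_unique:
  assumes "bounded_linear S" "bounded_linear T" "\<And>u v. S (ten u v) = T (ten u v)"
  shows "S = T"
proof -
  interpret S: bounded_linear S by (rule assms)
  interpret T: bounded_linear T by (rule assms)
  have "{z. S z = T z} = UNIV"
    by (intro eq_UNIV) (use assms in \<open>auto simp: subspace_def S.add T.add S.scaleR T.scaleR S.zero T.zero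
        intro!: closed_Collect_eq linear_continuous_on\<close>)
  then show ?thesis by auto
qed

text \<open>
Elementary tensors and their images under \<open>U \<otimes> V\<close> have the same inner products, so
\<open>isometric_extension\<close> applies. This makes the description in \<^const>\<open>tensor_rep\<close> definite.
\<close>

lemma tensor_operator_ex1:
  assumes U: "unitary_op U" and V: "unitary_op V"
  shows "\<exists>!T. unitary_op T \<and> (\<forall>u v. T (ten u v) = ten (U u) (V v))"
proof -
  define \<Gamma> where "\<Gamma> = {(ten u v, ten (U u) (V v)) | u v. True}"
  have "ten u v \<in> snd ` \<Gamma>" for u v
  proof -
    obtain u' v' where "u = U u'" "v = V v'" using U V unfolding unitary_op_def surj_def by metis
    then show ?thesis unfolding \<Gamma>_def by (force simp: image_iff)
  qed
  moreover have "snd ` \<Gamma> \<subseteq> elementary" unfolding \<Gamma>_def elementary_def by (auto; blast)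
  ultimately have snd: "snd ` \<Gamma> = elementary" by (auto simp: elementary_def)
  have fst: "fst ` \<Gamma> = elementary"
    unfolding \<Gamma>_def elementary_def by (auto simp: image_iff; blast)
  have sc: "(scaleC c x, scaleC c x') \<in> \<Gamma>" if "(x, x') \<in> \<Gamma>" for c x x'
  proof -
    obtain u v where uv: "x = ten u v" "x' = ten (U u) (V v)"
      using \<open>(x, x') \<in> \<Gamma>\<close> unfolding \<Gamma>_def by blast
    have "U (scaleC c u) = scaleC c (U u)" using U by (auto simp: unitary_op_def complex_linear_on_def)
    then have "(scaleC c x, scaleC c x') = (ten (scaleC c u) v, ten (U (scaleC c u)) (V v))"
      by (simp add: uv ten_scaleC_left)
    then show ?thesis unfolding \<Gamma>_def by blast
  qed
  have inner: "cinner x' y' = cinner x y" if "(x, x') \<in> \<Gamma>" "(y, y') \<in> \<Gamma>" for x x' y y'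
    using that U V by (auto simp: \<Gamma>_def cinner_ten unitary_op_def)
  obtain T where T: "complex_linear_on UNIV T" "surj T"
    "\<And>x y. cinner (T x) (T y) = cinner x y" "\<And>x x'. (x, x') \<in> \<Gamma> \<Longrightarrow> T x = x'"
    by (rule isometric_extension[of \<Gamma>, OF inner sc])
       (simp_all only: fst snd elementary_dense)
  have "(ten u v, ten (U u) (V v)) \<in> \<Gamma>" for u v unfolding \<Gamma>_def by blast
  with T have "unitary_op T \<and> (\<forall>u v. T (ten u v) = ten (U u) (V v))"
    by (simp add: unitary_op_def)
  moreover have "S = T" if "unitary_op S \<and> (\<forall>u v. S (ten u v) = ten (U u) (V v))" for S
    using that calculation by (intro tensor_operator_unique unitary_op_bounded_linear) auto
  ultimately show ?thesis by blast
qed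

end

lemma unitary_repD:
  assumes "unitary_rep \<pi>"
  shows "unitary_op (\<pi> x)" "\<pi> (x + y) = \<pi> x \<circ> \<pi> y" "\<pi> 0 = id"
    "cinner (\<pi> x u) w = cinner u (\<pi> (- x) w)"
    "continuous_on UNIV (wavelet_transform \<pi> g f)"
proof -
  show u: "unitary_op (\<pi> x)" and hom: "\<pi> (x + y) = \<pi> x \<circ> \<pi> y" for x y
    using assms by (auto simp: unitary_rep_def)
  show "continuous_on UNIV (wavelet_transform \<pi> g f)"
    using assms by (auto simp: unitary_rep_def)
  show id: "\<pi> 0 = id"
  proof
    fix u
    have "\<pi> 0 (\<pi> 0 u) = \<pi> 0 u" by (metis hom add_0 comp_apply)
    then show "\<pi> 0 u = id u" using unitary_op_bij[OF u[of 0]] by (simp add: bij_def inj_def)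
  qed
  have inv: "\<pi> x (\<pi> (- x) u) = u" for x u
    using hom[of x "- x"] id by (metis comp_apply id_apply right_minus)
  show "cinner (\<pi> x u) w = cinner u (\<pi> (- x) w)"
    using u[of x] inv[of x w] by (metis unitary_op_def)
qed

context tensor_model
begin

context
  fixes \<pi> :: "'a::{topological_space,group_add} \<Rightarrow> 'h \<Rightarrow> 'h"
    and \<rho> :: "'b::{topological_space,group_add} \<Rightarrow> 'k \<Rightarrow> 'k"
  assumes \<pi>: "unitary_rep \<pi>" and \<rho>: "unitary_rep \<rho>"
begin

lemma tensor_rep_unitary_op: "unitary_op (tensor_rep ten \<pi> \<rho> p)"
  and tensor_rep_ten: "tensor_rep ten \<pi> \<rho> p (ten u v) = ten (\<pi> (fst p) u) (\<rho> (snd p) v)"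
  using theI'[OF tensor_operator_ex1[OF unitary_repD(1)[OF \<pi>, of "fst p"] unitary_repD(1)[OF \<rho>, of "snd p"]]]
  by (auto simp: tensor_rep_def split_beta)

lemma wavelet_transform_ten:
  "wavelet_transform (tensor_rep ten \<pi> \<rho>) (ten g h) (ten u v) p =
     wavelet_transform \<pi> g u (fst p) * wavelet_transform \<rho> h v (snd p)"
  by (simp add: wavelet_transform_def tensor_rep_ten cinner_ten)

text \<open>
Matrix coefficients of elementary tensors are products of matrix coefficients of the factors and
hence jointly continuous. The operators being isometric, a coefficient depends continuously in the
uniform norm on its two vectors, so continuity passes to the closed span, in one vector at a time.
\<close>

lemma unitary_rep_tensor_rep: "unitary_rep (tensor_rep ten \<pi> \<rho>)"
proof -
  let ?T = "tensor_rep ten \<pi> \<rho>"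
  note bl = unitary_op_bounded_linear[OF tensor_rep_unitary_op]
  have hom: "?T (p + q) = ?T p \<circ> ?T q" for p q
  proof (rule tensor_operator_unique)
    show "bounded_linear (?T p \<circ> ?T q)"
      unfolding comp_def by (rule bounded_linear_compose[OF bl bl])
  qed (simp_all only: tensor_rep_ten bl unitary_repD(2)[OF \<pi>] unitary_repD(2)[OF \<rho>]
      fst_add snd_add comp_apply)
  define c where "c F G = (\<lambda>p. cinner F (?T p G))" for F G
  have bound: "cmod (c F G p) \<le> norm F * norm G" for F G p
    using cinner_Cauchy_Schwarz[of F "?T p G"] unitary_op_norm[OF tensor_rep_unitary_op]
    by (simp add: c_def)
  have add: "c (F + F') G = (\<lambda>p. c F G p + c F' G p)" "c F (G + G') = (\<lambda>p. c F G p + c F G' p)"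
    "c (r *\<^sub>R F) G = (\<lambda>p. r *\<^sub>R c F G p)" "c F (r *\<^sub>R G) = (\<lambda>p. r *\<^sub>R c F G p)"
    "c (F - F') G = (\<lambda>p. c F G p - c F' G p)" "c F (G - G') = (\<lambda>p. c F G p - c F G' p)"
    for F F' G G' r
    by (auto simp: c_def linear_simps[OF bl] cinner.add_left cinner.add_right cinner.scaleR_left
        cinner.scaleR_right cinner.diff_left cinner.diff_right)
  have zero: "c 0 G = (\<lambda>p. 0)" "c F 0 = (\<lambda>p. 0)" for F G
    by (auto simp: c_def linear_simps[OF bl] cinner.zero_left cinner.zero_right)
  have lim: "continuous_on UNIV (c F G)"
    if Fn: "\<And>n. continuous_on UNIV (c (Fn n) (Gn n))" "Fn \<longlonglongrightarrow> F" "Gn \<longlonglongrightarrow> G" for Fn Gn F G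
  proof (rule uniform_limit_theorem[where F = sequentially and f = "\<lambda>n. c (Fn n) (Gn n)"])
    show "uniform_limit UNIV (\<lambda>n. c (Fn n) (Gn n)) (c F G) sequentially"
    proof (rule uniform_limitI)
      fix e :: real assume "0 < e"
      have "(\<lambda>n. norm (Fn n - F) * norm (Gn n) + norm F * norm (Gn n - G)) \<longlonglongrightarrow> norm (F - F) * norm G + norm F * norm (G - G)"
        by (intro tendsto_intros Fn)
      then have "\<forall>\<^sub>F n in sequentially. norm (Fn n - F) * norm (Gn n) + norm F * norm (Gn n - G) < e"
        using \<open>0 < e\<close> by (intro order_tendstoD) auto
      then show "\<forall>\<^sub>F n in sequentially. \<forall>p\<in>UNIV. dist (c (Fn n) (Gn n) p) (c F G p) < e"
      proof eventually_elim
        case (elim n)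
        show ?case
        proof
          fix p
          have "c (Fn n) (Gn n) p - c F G p = c (Fn n - F) (Gn n) p + c F (Gn n - G) p"
            by (simp add: add)
          then have "dist (c (Fn n) (Gn n) p) (c F G p) \<le> cmod (c (Fn n - F) (Gn n) p) + cmod (c F (Gn n - G) p)"
            by (simp add: dist_norm norm_triangle_ineq)
          also have "\<dots> < e" using bound[of "Fn n - F" "Gn n" p] bound[of F "Gn n - G" p] elim by linarith
          finally show "dist (c (Fn n) (Gn n) p) (c F G p) < e" .
        qed
      qed
    qed
  qed (use Fn in auto)
  have ten_ten: "continuous_on UNIV (c (ten u v) (ten u' v'))" for u v u' v'
  proof -
    have "c (ten u v) (ten u' v') = (\<lambda>p. wavelet_transform \<pi> u' u (fst p) * wavelet_transform \<rho> v' v (snd p))"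
      by (auto simp: c_def tensor_rep_ten cinner_ten wavelet_transform_def)
    then show ?thesis
      by (auto intro!: continuous_on_mult
          continuous_on_compose2[OF unitary_repD(5)[OF \<pi>] continuous_on_fst[OF continuous_on_id]]
          continuous_on_compose2[OF unitary_repD(5)[OF \<rho>] continuous_on_snd[OF continuous_on_id]])
  qed
  have "{F. continuous_on UNIV (c F (ten u' v'))} = UNIV" for u' v'
  proof (rule eq_UNIV)
    show "closed {F. continuous_on UNIV (c F (ten u' v'))}"
      using lim[where Gn = "\<lambda>_. ten u' v'"] by (simp add: closed_sequential_limits) blast
  qed (simp_all add: ten_ten subspace_def zero add continuous_on_add continuous_on_scaleR)
  then have left: "continuous_on UNIV (c F (ten u' v'))" for F u' v' by auto
  have "{G. continuous_on UNIV (c F G)} = UNIV" for F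
  proof (rule eq_UNIV)
    show "closed {G. continuous_on UNIV (c F G)}"
      using lim[where Fn = "\<lambda>_. F"] by (simp add: closed_sequential_limits) blast
  qed (simp_all add: left subspace_def zero add continuous_on_add continuous_on_scaleR)
  then have "continuous_on UNIV (wavelet_transform ?T G F)" for F G
    by (auto simp: wavelet_transform_def c_def)
  then show ?thesis by (simp add: unitary_rep_def tensor_rep_unitary_op hom)
qed

end
end

section \<open>Integration against a Radon product\<close>

text \<open>
The levels are defined by strict inequalities \<open>k / 2 ^ n < t\<close>, so that for a continuous function in
place of \<open>t\<close> they cut out open sets. With \<open>4 ^ n\<close> levels of height \<open>1 / 2 ^ n\<close> stage \<open>n\<close> reaches up
to \<open>2 ^ n\<close>, hence above \<open>t\<close> eventually, and then misses \<open>t\<close> by at most one level.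
\<close>

lemma dyadic_layers:
  fixes t :: real
  assumes "0 \<le> t"
  defines "A \<equiv> \<lambda>n::nat. {k \<in> {1..4 ^ n :: nat}. real k / 2 ^ n < t}"
  shows "real (card (A n)) / 2 ^ n \<le> real (card (A (Suc n))) / 2 ^ Suc n"
    and "(\<lambda>n. real (card (A n)) / 2 ^ n) \<longlonglongrightarrow> t"
proof -
  have fin: "finite (A n)" for n by (simp add: A_def)
  have mem: "k \<in> A n \<longleftrightarrow> 1 \<le> k \<and> k \<le> 4 ^ n \<and> real k < 2 ^ n * t" for k n
    by (simp add: A_def field_simps)
  show "real (card (A n)) / 2 ^ n \<le> real (card (A (Suc n))) / 2 ^ Suc n" for n
  proof -
    \<comment> \<open>A level \<open>k\<close> counted at stage \<open>n\<close> yields the two levels \<open>2 * k\<close> and \<open>2 * k - 1\<close> at the next stage.\<close>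
    have "card ((\<lambda>k. 2 * k) ` A n \<union> (\<lambda>k. 2 * k - 1) ` A n)
        = card ((\<lambda>k. 2 * k) ` A n) + card ((\<lambda>k. 2 * k - 1) ` A n)"
    proof (rule card_Un_disjoint)
      have "2 * k \<noteq> 2 * l - 1" if "1 \<le> l" for k l :: nat using that by presburger
      then show "(\<lambda>k. 2 * k) ` A n \<inter> (\<lambda>k. 2 * k - 1) ` A n = {}" by (auto simp: mem)
    qed (auto simp: fin)
    also have "card ((\<lambda>k. 2 * k) ` A n) = card (A n)" by (rule card_image) (auto simp: inj_on_def)
    also have "card ((\<lambda>k. 2 * k - 1) ` A n) = card (A n)"
      by (rule card_image) (auto simp: inj_on_def mem)
    finally have "2 * card (A n) = card ((\<lambda>k. 2 * k) ` A n \<union> (\<lambda>k. 2 * k - 1) ` A n)" by simp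
    also have "\<dots> \<le> card (A (Suc n))"
    proof (rule card_mono[OF fin], rule Un_least)
      show "(\<lambda>k. 2 * k) ` A n \<subseteq> A (Suc n)"
        by (auto simp: mem algebra_simps)
      show "(\<lambda>k. 2 * k - 1) ` A n \<subseteq> A (Suc n)"
      proof clarify
        fix k assume "k \<in> A n"
        then have k: "1 \<le> k" "k \<le> 4 ^ n" "real k < 2 ^ n * t" by (auto simp: mem)
        have "real (2 * k - 1) = 2 * real k - 1" using k(1) by (simp add: of_nat_diff)
        then have "real (2 * k - 1) < 2 ^ Suc n * t" using k(3) by simp
        then show "2 * k - 1 \<in> A (Suc n)" using k by (simp add: mem) linarith
      qed
    qed
    finally have "2 * real (card (A n)) \<le> real (card (A (Suc n)))" by linarith
    then show ?thesis by (simp add: field_simps)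
  qed
  have upper: "real (card (A n)) \<le> 2 ^ n * t" for n
  proof -
    have "A n \<subseteq> {1..nat \<lfloor>2 ^ n * t\<rfloor>}" by (auto simp: mem le_nat_floor)
    then have "card (A n) \<le> nat \<lfloor>2 ^ n * t\<rfloor>" using card_mono[of "{1..nat \<lfloor>2 ^ n * t\<rfloor>}"] by force
    moreover have "real (nat \<lfloor>2 ^ n * t\<rfloor>) \<le> 2 ^ n * t" using assms(1) by (intro of_nat_floor) simp
    ultimately show ?thesis by linarith
  qed
  have lower: "t * 2 ^ n - 1 \<le> real (card (A n))" if "t \<le> 2 ^ n" for n
  proof -
    define m where "m = nat \<lceil>2 ^ n * t\<rceil> - 1"
    have "{1..m} \<subseteq> A n"
    proof
      fix k assume k: "k \<in> {1..m}"
      then have "real k < 2 ^ n * t" unfolding m_def by simp linarith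
      moreover have "2 ^ n * t \<le> 2 ^ n * 2 ^ n" using that by simp
      then have "2 ^ n * t \<le> real (4 ^ n)" by (simp flip: power_mult_distrib)
      ultimately have "real k \<le> real (4 ^ n)" by linarith
      then have "k \<le> 4 ^ n" by (simp only: of_nat_le_iff)
      with \<open>real k < 2 ^ n * t\<close> show "k \<in> A n" using k by (simp add: mem)
    qed
    then have "card {1..m} \<le> card (A n)" by (rule card_mono[OF fin])
    then have "m \<le> card (A n)" by simp
    moreover have "2 ^ n * t - 1 \<le> real m" unfolding m_def by linarith
    ultimately show ?thesis by (simp add: mult.commute)
  qed
  obtain N where N: "t < 2 ^ N" using real_arch_pow[of 2 t] by auto
  show "(\<lambda>n. real (card (A n)) / 2 ^ n) \<longlonglongrightarrow> t"
  proof (rule tendsto_sandwich[of "\<lambda>n. t - (1 / 2) ^ n" _ _ "\<lambda>_. t"])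
    have "t \<le> 2 ^ n" if "N \<le> n" for n
      using N power_increasing[OF that, of "2::real"] by linarith
    then have "t - (1 / 2) ^ n \<le> real (card (A n)) / 2 ^ n" if "N \<le> n" for n
      using lower[of n] that
      by (simp add: pos_le_divide_eq left_diff_distrib power_one_over)
    then show "\<forall>\<^sub>F n in sequentially. t - (1 / 2) ^ n \<le> real (card (A n)) / 2 ^ n"
      by (auto simp: eventually_sequentially)
    show "\<forall>\<^sub>F n in sequentially. real (card (A n)) / 2 ^ n \<le> t"
      using upper by (intro always_eventually allI) (simp add: field_simps)
    have "(\<lambda>n. t - (1 / 2) ^ n) \<longlonglongrightarrow> t - 0"
      by (intro tendsto_intros LIMSEQ_power_zero) simp
    then show "(\<lambda>n. t - (1 / 2) ^ n) \<longlonglongrightarrow> t" by simp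
  qed simp
qed

text \<open>
A nonnegative continuous function is the increasing limit of combinations of indicators of its
open superlevel sets, so its integral is determined by the measures of open sets. The layers are
discrete because Tonelli's theorem cannot be applied to the region below the graph: a Haar measure
need not be sigma-finite, as counting measure on an uncountable discrete group shows.
\<close>

lemma nn_integral_eq_of_open_sets:
  fixes \<phi> :: "'a::topological_space \<Rightarrow> real"
  assumes M: "sets M = sets borel" and N: "sets N = sets borel"
    and opens: "\<And>U. open U \<Longrightarrow> emeasure N U = c * emeasure M U"
    and cont: "continuous_on UNIV \<phi>" and nonneg: "\<And>x. 0 \<le> \<phi> x"
  shows "(\<integral>\<^sup>+x. ennreal (\<phi> x) \<partial>N) = c * (\<integral>\<^sup>+x. ennreal (\<phi> x) \<partial>M)"
proof -
  define U where "U n k = {x. real k / 2 ^ n < \<phi> x}" for n k :: nat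
  define a where "a n x = (\<Sum>k\<in>{1..4 ^ n}. ennreal (1 / 2 ^ n) * indicator (U n k) x)" for n x
  have openU: "open (U n k)" for n k
    unfolding U_def by (intro open_Collect_less continuous_intros cont)
  have U_sets: "U n k \<in> sets M" "U n k \<in> sets N" for n k using openU by (simp_all add: M N)
  have a_eq: "a n x = ennreal (real (card {k \<in> {1..4 ^ n :: nat}. real k / 2 ^ n < \<phi> x}) / 2 ^ n)" for n x
  proof -
    have "a n x = ennreal (1 / 2 ^ n) * (\<Sum>k\<in>{1..4 ^ n}. indicator {k. real k / 2 ^ n < \<phi> x} k)"
      by (simp add: a_def U_def sum_distrib_left indicator_def mult.commute)
    also have "(\<Sum>k\<in>{1..4 ^ n}. indicator {k. real k / 2 ^ n < \<phi> x} k :: ennreal)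
        = of_nat (card {k \<in> {1..4 ^ n :: nat}. real k / 2 ^ n < \<phi> x})"
    proof -
      have "{k \<in> {1..4 ^ n :: nat}. real k / 2 ^ n < \<phi> x} = {1..4 ^ n} \<inter> {k. real k / 2 ^ n < \<phi> x}" by auto
      then show ?thesis by (simp add: indicator_def)
    qed
    finally show ?thesis
      unfolding ennreal_of_nat_eq_real_of_nat by (subst (asm) ennreal_mult[symmetric]) simp_all
  qed
  have inc: "incseq a"
    unfolding a_eq[abs_def] using dyadic_layers(1)[OF nonneg]
    by (intro incseq_SucI le_funI ennreal_leI) simp
  have sup: "(SUP n. a n x) = ennreal (\<phi> x)" for x
  proof (rule LIMSEQ_unique)
    show "(\<lambda>n. a n x) \<longlonglongrightarrow> (SUP n. a n x)"
      using inc by (intro LIMSEQ_SUP) (auto simp: incseq_def le_fun_def)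
    show "(\<lambda>n. a n x) \<longlonglongrightarrow> ennreal (\<phi> x)"
      unfolding a_eq by (intro tendsto_ennrealI dyadic_layers(2)[OF nonneg])
  qed
  have meas: "a n \<in> borel_measurable M" "a n \<in> borel_measurable N" for n
    unfolding a_def[abs_def] using U_sets by measurable
  have layers: "(\<integral>\<^sup>+x. a n x \<partial>L) = (\<Sum>k\<in>{1..4 ^ n}. ennreal (1 / 2 ^ n) * emeasure L (U n k))"
    if "\<And>k. U n k \<in> sets L" for L n
  proof -
    note that[measurable]
    have "(\<integral>\<^sup>+x. a n x \<partial>L) = (\<Sum>k\<in>{1..4 ^ n}. \<integral>\<^sup>+x. ennreal (1 / 2 ^ n) * indicator (U n k) x \<partial>L)"
      unfolding a_def using that by (intro nn_integral_sum) measurable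
    also have "\<dots> = (\<Sum>k\<in>{1..4 ^ n}. ennreal (1 / 2 ^ n) * emeasure L (U n k))"
      by (intro sum.cong refl nn_integral_cmult_indicator that)
    finally show ?thesis .
  qed
  have int: "(\<integral>\<^sup>+x. a n x \<partial>N) = c * (\<integral>\<^sup>+x. a n x \<partial>M)" for n
    unfolding layers[OF U_sets(1)] layers[OF U_sets(2)] sum_distrib_left
    by (intro sum.cong refl) (simp add: opens openU mult_ac)
  have "(\<integral>\<^sup>+x. ennreal (\<phi> x) \<partial>N) = (SUP n. \<integral>\<^sup>+x. a n x \<partial>N)"
    unfolding sup[symmetric] by (intro nn_integral_monotone_convergence_SUP inc meas)
  also have "\<dots> = c * (SUP n. \<integral>\<^sup>+x. a n x \<partial>M)"
    unfolding int by (simp add: SUP_mult_left_ennreal)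
  also have "(SUP n. \<integral>\<^sup>+x. a n x \<partial>M) = (\<integral>\<^sup>+x. ennreal (\<phi> x) \<partial>M)"
    unfolding sup[symmetric] by (intro nn_integral_monotone_convergence_SUP[symmetric] inc meas)
  finally show ?thesis .
qed

lemma radon_measure_sets: "sets \<mu> = sets borel" if "radon_measure \<mu>"
  using that unfolding radon_measure_def by (elim conjE)

lemma radon_measure_open:
  assumes "radon_measure \<mu>" "open U"
  shows "emeasure \<mu> U = (SUP K\<in>{K. compact K \<and> K \<subseteq> U}. emeasure \<mu> K)"
proof -
  have "\<forall>U. open U \<longrightarrow> emeasure \<mu> U = (SUP K\<in>{K. compact K \<and> K \<subseteq> U}. emeasure \<mu> K)"
    using assms(1) unfolding radon_measure_def by (elim conjE)
  with assms(2) show ?thesis by (elim allE impE)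
qed

context
  fixes \<mu> :: "'a::t2_space measure" and \<nu> :: "'b::t2_space measure" and \<kappa> :: "('a \<times> 'b) measure"
  assumes \<mu>: "radon_measure \<mu>" and \<nu>: "radon_measure \<nu>" and \<kappa>: "radon_product_measure \<mu> \<nu> \<kappa>"
begin

lemma radon_product: "radon_measure \<kappa>"
  using \<kappa> by (simp only: radon_product_measure_def)

lemma sets_radon_product: "sets \<mu> = sets borel" "sets \<nu> = sets borel" "sets \<kappa> = sets borel"
  using radon_measure_sets \<mu> \<nu> radon_product by blast+

lemma space_radon_product: "space \<mu> = UNIV" "space \<nu> = UNIV" "space \<kappa> = UNIV"
  using sets_radon_product by (auto dest: sets_eq_imp_space_eq)

text \<open>
By inner regularity an open set has the measure of its large compact subsets, and a compact subset
of a rectangle lies in the compact rectangle formed by its two projections.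
\<close>

lemma emeasure_open_rectangle:
  assumes "open U" "open V"
  shows "emeasure \<kappa> (U \<times> V) = emeasure \<mu> U * emeasure \<nu> V"
proof (rule antisym)
  have inner: "emeasure \<mu> U = (SUP K\<in>{K. compact K \<and> K \<subseteq> U}. emeasure \<mu> K)"
    "emeasure \<nu> V = (SUP L\<in>{L. compact L \<and> L \<subseteq> V}. emeasure \<nu> L)"
    "emeasure \<kappa> (U \<times> V) = (SUP C\<in>{C. compact C \<and> C \<subseteq> U \<times> V}. emeasure \<kappa> C)"
    using radon_measure_open[OF \<mu> assms(1)] radon_measure_open[OF \<nu> assms(2)]
      radon_measure_open[OF radon_product open_Times[OF assms]] by this
  have rect: "emeasure \<kappa> (K \<times> L) = emeasure \<mu> K * emeasure \<nu> L" if "compact K" "compact L" for K L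
    using \<kappa> that by (simp only: radon_product_measure_def)
  have UV: "U \<in> sets \<mu>" "V \<in> sets \<nu>" "U \<times> V \<in> sets \<kappa>"
    using assms open_Times[OF assms] by (simp_all add: sets_radon_product)
  show "emeasure \<kappa> (U \<times> V) \<le> emeasure \<mu> U * emeasure \<nu> V"
    unfolding inner(3)
  proof (rule SUP_least, clarify)
    fix C assume C: "compact C" "C \<subseteq> U \<times> V"
    have cpt: "compact (fst ` C)" "compact (snd ` C)"
      by (rule compact_continuous_image[OF _ C(1)],
          rule continuous_on_fst[OF continuous_on_id] continuous_on_snd[OF continuous_on_id])+
    have "emeasure \<kappa> C \<le> emeasure \<kappa> (fst ` C \<times> snd ` C)"
      using cpt by (intro emeasure_mono subset_fst_snd)
        (simp add: sets_radon_product borel_compact compact_Times)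
    also have "\<dots> = emeasure \<mu> (fst ` C) * emeasure \<nu> (snd ` C)" by (rule rect[OF cpt])
    also have "\<dots> \<le> emeasure \<mu> U * emeasure \<nu> V"
      using C(2) UV by (intro mult_mono emeasure_mono) auto
    finally show "emeasure \<kappa> C \<le> emeasure \<mu> U * emeasure \<nu> V" .
  qed
  show "emeasure \<mu> U * emeasure \<nu> V \<le> emeasure \<kappa> (U \<times> V)"
    unfolding inner(1) SUP_mult_right_ennreal
  proof (rule SUP_least)
    fix K assume K: "K \<in> {K. compact K \<and> K \<subseteq> U}"
    show "emeasure \<mu> K * emeasure \<nu> V \<le> emeasure \<kappa> (U \<times> V)"
      unfolding inner(2) SUP_mult_left_ennreal
    proof (rule SUP_least)
      fix L assume L: "L \<in> {L. compact L \<and> L \<subseteq> V}"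
      have "emeasure \<mu> K * emeasure \<nu> L = emeasure \<kappa> (K \<times> L)" using K L by (simp add: rect)
      also have "\<dots> \<le> emeasure \<kappa> (U \<times> V)" using K L UV by (intro emeasure_mono) auto
      finally show "emeasure \<mu> K * emeasure \<nu> L \<le> emeasure \<kappa> (U \<times> V)" .
    qed
  qed
qed

text \<open>
A substitute for Tonelli's theorem. The Radon product is multiplicative on open rectangles, but on
Borel sets it may differ from iterated integration. Continuous functions see only open sets:
\<open>nn_integral_eq_of_open_sets\<close> is applied to the measure \<open>U \<mapsto> \<kappa> (U \<times> V)\<close> for a fixed open \<open>V\<close>, and
then to the measure that sends \<open>V\<close> to the integral of \<open>\<phi>\<close> over the strip \<open>UNIV \<times> V\<close>.
\<close>

lemma nn_integral_radon_product:
  fixes \<phi> :: "'a \<Rightarrow> real" and \<psi> :: "'b \<Rightarrow> real"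
  assumes \<phi>: "continuous_on UNIV \<phi>" "\<And>x. 0 \<le> \<phi> x" and \<psi>: "continuous_on UNIV \<psi>" "\<And>y. 0 \<le> \<psi> y"
  shows "(\<integral>\<^sup>+p. ennreal (\<phi> (fst p) * \<psi> (snd p)) \<partial>\<kappa>) =
    (\<integral>\<^sup>+x. ennreal (\<phi> x) \<partial>\<mu>) * (\<integral>\<^sup>+y. ennreal (\<psi> y) \<partial>\<nu>)"
proof -
  have [measurable]: "fst \<in> measurable \<kappa> borel" "snd \<in> measurable \<kappa> borel"
    using borel_measurable_continuous_onI[OF continuous_on_fst[OF continuous_on_id]]
      borel_measurable_continuous_onI[OF continuous_on_snd[OF continuous_on_id]]
    by (simp_all add: measurable_cong_sets[OF sets_radon_product(3) refl])
  have [measurable]: "\<phi> \<in> borel_measurable borel" "\<psi> \<in> borel_measurable borel"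
    using \<phi> \<psi> by (simp_all add: borel_measurable_continuous_onI)
  have strip: "(\<integral>\<^sup>+p. ennreal (\<phi> (fst p)) * indicator V (snd p) \<partial>\<kappa>)
      = (\<integral>\<^sup>+x. ennreal (\<phi> x) \<partial>\<mu>) * emeasure \<nu> V" if V: "open V" for V
  proof -
    have [measurable]: "V \<in> sets borel" using V by simp
    define N where "N = distr (density \<kappa> (\<lambda>p. indicator V (snd p))) borel fst"
    have "emeasure N U = emeasure \<nu> V * emeasure \<mu> U" if U: "open U" for U
    proof -
      have [measurable]: "U \<in> sets borel" using U by simp
      have "emeasure N U = (\<integral>\<^sup>+p. indicator V (snd p) * indicator (fst -` U \<inter> space \<kappa>) p \<partial>\<kappa>)"
        unfolding N_def by (subst emeasure_distr) (auto simp: emeasure_density)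
      also have "\<dots> = (\<integral>\<^sup>+p. indicator (U \<times> V) p \<partial>\<kappa>)"
        by (intro nn_integral_cong) (auto simp: space_radon_product split: split_indicator)
      also have "\<dots> = emeasure \<kappa> (U \<times> V)"
        using open_Times[OF U V] by (simp add: sets_radon_product)
      finally show ?thesis using emeasure_open_rectangle[OF U V] by (simp add: mult.commute)
    qed
    then have "(\<integral>\<^sup>+x. ennreal (\<phi> x) \<partial>N) = emeasure \<nu> V * (\<integral>\<^sup>+x. ennreal (\<phi> x) \<partial>\<mu>)"
      using \<phi> by (intro nn_integral_eq_of_open_sets) (auto simp: N_def sets_radon_product)
    moreover have "(\<integral>\<^sup>+x. ennreal (\<phi> x) \<partial>N) = (\<integral>\<^sup>+p. ennreal (\<phi> (fst p)) * indicator V (snd p) \<partial>\<kappa>)"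
      unfolding N_def by (simp add: nn_integral_distr nn_integral_density mult.commute)
    ultimately show ?thesis by (simp add: mult.commute)
  qed
  define N where "N = distr (density \<kappa> (\<lambda>p. ennreal (\<phi> (fst p)))) borel snd"
  have "emeasure N V = (\<integral>\<^sup>+x. ennreal (\<phi> x) \<partial>\<mu>) * emeasure \<nu> V" if V: "open V" for V
  proof -
    have [measurable]: "V \<in> sets borel" using V by simp
    have "emeasure N V = (\<integral>\<^sup>+p. ennreal (\<phi> (fst p)) * indicator (snd -` V \<inter> space \<kappa>) p \<partial>\<kappa>)"
      unfolding N_def by (subst emeasure_distr) (auto simp: emeasure_density)
    also have "\<dots> = (\<integral>\<^sup>+p. ennreal (\<phi> (fst p)) * indicator V (snd p) \<partial>\<kappa>)"
      by (intro nn_integral_cong) (auto simp: space_radon_product split: split_indicator)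
    finally show ?thesis by (simp add: strip[OF V])
  qed
  then have "(\<integral>\<^sup>+y. ennreal (\<psi> y) \<partial>N) = (\<integral>\<^sup>+x. ennreal (\<phi> x) \<partial>\<mu>) * (\<integral>\<^sup>+y. ennreal (\<psi> y) \<partial>\<nu>)"
    using \<psi> by (intro nn_integral_eq_of_open_sets) (auto simp: N_def sets_radon_product)
  moreover have "(\<integral>\<^sup>+y. ennreal (\<psi> y) \<partial>N) = (\<integral>\<^sup>+p. ennreal (\<phi> (fst p) * \<psi> (snd p)) \<partial>\<kappa>)"
    unfolding N_def using \<phi>(2) \<psi>(2) by (simp add: nn_integral_distr nn_integral_density ennreal_mult)
  ultimately show ?thesis by simp
qed

end

section \<open>Square integrability of the tensor product\<close>

text \<open>
The real and imaginary parts of a continuous integrable function, and their positive and negative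
parts, are again continuous and integrable.
\<close>

lemma continuous_integrable_induct:
  fixes a :: "'a::topological_space \<Rightarrow> complex"
  assumes cont: "continuous_on UNIV a" and int: "integrable M a"
    and nonneg: "\<And>\<phi> :: 'a \<Rightarrow> real. continuous_on UNIV \<phi> \<Longrightarrow> integrable M \<phi> \<Longrightarrow> (\<And>x. 0 \<le> \<phi> x) \<Longrightarrow>
      Q (\<lambda>x. complex_of_real (\<phi> x))"
    and lin: "\<And>f f' c. integrable M f \<Longrightarrow> integrable M f' \<Longrightarrow> Q f \<Longrightarrow> Q f' \<Longrightarrow> Q (\<lambda>x. f x + c * f' x)"
  shows "Q a"
proof -
  have real: "integrable M (\<lambda>x. complex_of_real (r x)) \<and> Q (\<lambda>x. complex_of_real (r x))"
    if r: "continuous_on UNIV r" "integrable M r" for r :: "'a \<Rightarrow> real"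
  proof
    have parts: "continuous_on UNIV (\<lambda>x. max 0 (r x))" "continuous_on UNIV (\<lambda>x. max 0 (- r x))"
      "integrable M (\<lambda>x. max 0 (r x))" "integrable M (\<lambda>x. max 0 (- r x))"
      using r by (auto intro!: continuous_intros integrable_max)
    have eq: "(\<lambda>x. complex_of_real (r x))
        = (\<lambda>x. complex_of_real (max 0 (r x)) + (- 1) * complex_of_real (max 0 (- r x)))"
      by (auto simp: max_def)
    show "Q (\<lambda>x. complex_of_real (r x))"
      by (subst eq) (use parts in \<open>intro lin nonneg integrable_of_real, auto\<close>)
  qed (use r in \<open>simp add: integrable_of_real\<close>)
  have eq: "a = (\<lambda>x. complex_of_real (Re (a x)) + \<i> * complex_of_real (Im (a x)))"
    by (auto simp: complex_eq_iff)
  have "continuous_on UNIV (\<lambda>x. Re (a x))" "continuous_on UNIV (\<lambda>x. Im (a x))"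
    by (intro continuous_intros cont)+
  with int have "Q (\<lambda>x. complex_of_real (Re (a x)) + \<i> * complex_of_real (Im (a x)))"
    using real[of "\<lambda>x. Re (a x)"] real[of "\<lambda>x. Im (a x)"] by (intro lin) auto
  then show ?thesis by (subst eq)
qed

lemma integral_radon_product:
  fixes \<mu> :: "'a::t2_space measure" and \<nu> :: "'b::t2_space measure"
    and a :: "'a \<Rightarrow> complex" and b :: "'b \<Rightarrow> complex"
  assumes \<mu>: "radon_measure \<mu>" and \<nu>: "radon_measure \<nu>" and \<kappa>: "radon_product_measure \<mu> \<nu> \<kappa>"
    and a: "continuous_on UNIV a" "integrable \<mu> a" and b: "continuous_on UNIV b" "integrable \<nu> b"
  shows "has_bochner_integral \<kappa> (\<lambda>p. a (fst p) * b (snd p)) ((LINT x|\<mu>. a x) * (LINT y|\<nu>. b y))"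
proof -
  note sets = sets_radon_product[OF \<mu> \<nu> \<kappa>]
  have nonneg: "has_bochner_integral \<kappa> (\<lambda>p. complex_of_real (\<phi> (fst p)) * complex_of_real (\<psi> (snd p)))
      ((LINT x|\<mu>. complex_of_real (\<phi> x)) * (LINT y|\<nu>. complex_of_real (\<psi> y)))"
    if \<phi>: "continuous_on UNIV \<phi>" "integrable \<mu> \<phi>" "\<And>x. 0 \<le> \<phi> x"
      and \<psi>: "continuous_on UNIV \<psi>" "integrable \<nu> \<psi>" "\<And>y. 0 \<le> \<psi> y" for \<phi> \<psi>
  proof -
    have "has_bochner_integral \<kappa> (\<lambda>p. \<phi> (fst p) * \<psi> (snd p)) ((LINT x|\<mu>. \<phi> x) * (LINT y|\<nu>. \<psi> y))"
    proof (rule has_bochner_integral_nn_integral)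
      have "continuous_on UNIV (\<lambda>p. \<phi> (fst p) * \<psi> (snd p))"
        by (auto intro!: continuous_on_mult
            continuous_on_compose2[OF \<phi>(1) continuous_on_fst[OF continuous_on_id]]
            continuous_on_compose2[OF \<psi>(1) continuous_on_snd[OF continuous_on_id]])
      then show "(\<lambda>p. \<phi> (fst p) * \<psi> (snd p)) \<in> borel_measurable \<kappa>"
        using borel_measurable_continuous_onI by (simp add: measurable_cong_sets[OF sets(3) refl])
      show "(\<integral>\<^sup>+p. ennreal (\<phi> (fst p) * \<psi> (snd p)) \<partial>\<kappa>) = ennreal ((LINT x|\<mu>. \<phi> x) * (LINT y|\<nu>. \<psi> y))"
        unfolding nn_integral_radon_product[OF \<mu> \<nu> \<kappa> \<phi>(1,3) \<psi>(1,3)]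
        using \<phi> \<psi> by (simp add: nn_integral_eq_integral ennreal_mult integral_nonneg_AE)
    qed (use \<phi> \<psi> in \<open>auto simp: integral_nonneg_AE\<close>)
    from has_bochner_integral_of_real[OF this, where 'a = complex]
    show ?thesis by (simp add: \<phi> \<psi>)
  qed
  have left: "has_bochner_integral \<kappa> (\<lambda>p. a (fst p) * complex_of_real (\<psi> (snd p)))
      ((LINT x|\<mu>. a x) * (LINT y|\<nu>. complex_of_real (\<psi> y)))"
    if \<psi>: "continuous_on UNIV \<psi>" "integrable \<nu> \<psi>" "\<And>y. 0 \<le> \<psi> y" for \<psi>
  proof (rule continuous_integrable_induct[OF a])
    fix f f' :: "'a \<Rightarrow> complex" and c
    assume int: "integrable \<mu> f" "integrable \<mu> f'"
      and f: "has_bochner_integral \<kappa> (\<lambda>p. f (fst p) * complex_of_real (\<psi> (snd p)))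
        ((LINT x|\<mu>. f x) * (LINT y|\<nu>. complex_of_real (\<psi> y)))"
      and f': "has_bochner_integral \<kappa> (\<lambda>p. f' (fst p) * complex_of_real (\<psi> (snd p)))
        ((LINT x|\<mu>. f' x) * (LINT y|\<nu>. complex_of_real (\<psi> y)))"
    show "has_bochner_integral \<kappa> (\<lambda>p. (f (fst p) + c * f' (fst p)) * complex_of_real (\<psi> (snd p)))
        ((LINT x|\<mu>. f x + c * f' x) * (LINT y|\<nu>. complex_of_real (\<psi> y)))"
      using has_bochner_integral_add[OF f has_bochner_integral_mult_right[OF f', of c]] int
      by (simp add: algebra_simps)
  qed (use nonneg \<psi> in auto)
  show ?thesis
  proof (rule continuous_integrable_induct[OF b])
    fix f f' :: "'b \<Rightarrow> complex" and c
    assume int: "integrable \<nu> f" "integrable \<nu> f'"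
      and f: "has_bochner_integral \<kappa> (\<lambda>p. a (fst p) * f (snd p)) ((LINT x|\<mu>. a x) * (LINT y|\<nu>. f y))"
      and f': "has_bochner_integral \<kappa> (\<lambda>p. a (fst p) * f' (snd p)) ((LINT x|\<mu>. a x) * (LINT y|\<nu>. f' y))"
    show "has_bochner_integral \<kappa> (\<lambda>p. a (fst p) * (f (snd p) + c * f' (snd p)))
        ((LINT x|\<mu>. a x) * (LINT y|\<nu>. f y + c * f' y))"
      using has_bochner_integral_add[OF f has_bochner_integral_mult_right[OF f', of c]] int
      by (simp add: algebra_simps)
  qed (use left in auto)
qed

lemma integrable_mult_of_in_L2:
  assumes "in_L2 M F" "in_L2 M G"
  shows "integrable M (\<lambda>x. F x * cnj (G x))"
proof (rule Bochner_Integration.integrable_bound)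
  show "integrable M (\<lambda>x. (cmod (F x))\<^sup>2 + (cmod (G x))\<^sup>2)"
    using assms by (simp add: in_L2_def)
  show "(\<lambda>x. F x * cnj (G x)) \<in> borel_measurable M"
    using assms unfolding in_L2_def
    by (intro borel_measurable_times borel_measurable_continuous_on[of cnj] continuous_intros) simp_all
  have "cmod (F x) * cmod (G x) \<le> (cmod (F x))\<^sup>2 + (cmod (G x))\<^sup>2" for x
    using sum_squares_bound[of "cmod (F x)" "cmod (G x)"]
      mult_nonneg_nonneg[OF norm_ge_zero norm_ge_zero, of "F x" "G x"] by linarith
  then show "AE x in M. norm (F x * cnj (G x)) \<le> norm ((cmod (F x))\<^sup>2 + (cmod (G x))\<^sup>2)"
    by (simp add: norm_mult)
qed

text \<open>
On the span of the total set \<open>E\<close> this follows from \<open>E\<close> by sesquilinearity. Since \<open>W\<close> is pointwise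
continuous, Fatou's lemma then gives that \<open>W\<close> never increases norms. So the defect
\<open>D F = \<parallel>F\<parallel>\<^sup>2 - \<parallel>W F\<parallel>\<^sup>2\<close> is a nonnegative quadratic form which vanishes on a dense subspace and is
bounded by the squared norm; the parallelogram law for \<open>D\<close> forces it to vanish everywhere.
\<close>

lemma isometric_coefficient_map:
  fixes k :: "'x \<Rightarrow> 't::complex_hilbert"
  defines "W \<equiv> \<lambda>F p. cinner F (k p)"
  assumes meas: "\<And>F. W F \<in> borel_measurable M"
    and dense: "closure (span E) = UNIV"
    and E: "\<And>e e'. e \<in> E \<Longrightarrow> e' \<in> E \<Longrightarrow> has_bochner_integral M (\<lambda>p. W e p * cnj (W e' p)) (cinner e e')"
  shows "in_L2 M (W F)" and "(LINT p|M. (cmod (W F p))\<^sup>2) = (norm F)\<^sup>2"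
proof -
  have W_add: "W (F + G) p = W F p + W G p" and W_diff: "W (F - G) p = W F p - W G p"
    and W_scaleR: "W (r *\<^sub>R F) p = r *\<^sub>R W F p" for F G p r
    by (simp_all add: W_def cinner.add_left cinner.diff_left cinner.scaleR_left)
  let ?I = "\<lambda>F G. has_bochner_integral M (\<lambda>p. W F p * cnj (W G p)) (cinner F G)"
  have left: "?I F e" if "F \<in> span E" "e \<in> E" for F e
    using that(1)
  proof (induction rule: span_induct)
    show "subspace {F. ?I F e}"
      by (auto simp: subspace_def W_def cinner.zero_left cinner.add_left cinner.scaleR_left
          distrib_right intro!: has_bochner_integral_add has_bochner_integral_scaleR_right)
  qed (use E that in auto)
  have both: "?I F G" if "F \<in> span E" "G \<in> span E" for F G
    using that(2)
  proof (induction rule: span_induct)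
    show "subspace {G. ?I F G}"
      by (auto simp: subspace_def W_def cinner.zero_left cinner.zero_right cinner.add_left cinner.add_right
          cinner.scaleR_left cinner.scaleR_right distrib_left intro!: has_bochner_integral_add has_bochner_integral_scaleR_right)
  qed (use left that in auto)
  have span: "has_bochner_integral M (\<lambda>p. (cmod (W F p))\<^sup>2) ((norm F)\<^sup>2)" if "F \<in> span E" for F
    using has_bochner_integral_Re[OF both[OF that that]]
    by (simp add: Re_cinner_self flip: complex_norm_square)
  have span_nn: "(\<integral>\<^sup>+p. ennreal ((cmod (W F p))\<^sup>2) \<partial>M) = ennreal ((norm F)\<^sup>2)" if "F \<in> span E" for F
    using span[OF that] by (subst nn_integral_eq_integral) (auto simp: has_bochner_integral_iff)
  have seq: "\<exists>s. (\<forall>n. s n \<in> span E) \<and> s \<longlonglongrightarrow> F" for F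
    using dense by (metis UNIV_I closure_sequential)
  have bound: "(\<integral>\<^sup>+p. ennreal ((cmod (W F p))\<^sup>2) \<partial>M) \<le> ennreal ((norm F)\<^sup>2)" for F
  proof -
    obtain s where s: "\<And>n. s n \<in> span E" "s \<longlonglongrightarrow> F" using seq[of F] by blast
    have "liminf (\<lambda>n. ennreal ((cmod (W (s n) p))\<^sup>2)) = ennreal ((cmod (W F p))\<^sup>2)" for p
      unfolding W_def using s(2)
      by (intro lim_imp_Liminf tendsto_intros tendsto_ennrealI cinner.tendsto) simp_all
    then have "(\<integral>\<^sup>+p. ennreal ((cmod (W F p))\<^sup>2) \<partial>M)
        = (\<integral>\<^sup>+p. liminf (\<lambda>n. ennreal ((cmod (W (s n) p))\<^sup>2)) \<partial>M)"
      by simp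
    also have "\<dots> \<le> liminf (\<lambda>n. \<integral>\<^sup>+p. ennreal ((cmod (W (s n) p))\<^sup>2) \<partial>M)"
      using meas by (intro nn_integral_liminf) simp
    also have "\<dots> = liminf (\<lambda>n. ennreal ((norm (s n))\<^sup>2))" by (simp add: span_nn s(1))
    also have "\<dots> = ennreal ((norm F)\<^sup>2)"
      using s(2) by (intro lim_imp_Liminf tendsto_ennrealI tendsto_intros) simp_all
    finally show ?thesis .
  qed
  have int: "integrable M (\<lambda>p. (cmod (W F p))\<^sup>2)" for F
    using meas bound[of F] by (intro integrableI_bounded) (auto simp: le_less_trans)
  then show "in_L2 M (W F)" for F using meas by (simp add: in_L2_def)
  define D where "D F = (norm F)\<^sup>2 - (LINT p|M. (cmod (W F p))\<^sup>2)" for F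
  have D_nonneg: "0 \<le> D F" for F
    using bound[of F] nn_integral_eq_integral[OF int[of F]] by (simp add: D_def)
  have D_le: "D F \<le> (norm F)\<^sup>2" for F by (simp add: D_def)
  have D_span: "D F = 0" if "F \<in> span E" for F
    using span[OF that] by (simp add: D_def has_bochner_integral_iff)
  have D_parallelogram: "D (F + G) + D (F - G) = 2 * D F + 2 * D G" for F G
  proof -
    have "(cmod (W (F + G) p))\<^sup>2 + (cmod (W (F - G) p))\<^sup>2 = 2 * (cmod (W F p))\<^sup>2 + 2 * (cmod (W G p))\<^sup>2" for p
      by (simp add: W_add W_diff cmod_power2) (simp add: power2_eq_square algebra_simps)
    then have "(LINT p|M. (cmod (W (F + G) p))\<^sup>2 + (cmod (W (F - G) p))\<^sup>2)
        = (LINT p|M. 2 * (cmod (W F p))\<^sup>2 + 2 * (cmod (W G p))\<^sup>2)"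
      by (simp only:)
    then have "(LINT p|M. (cmod (W (F + G) p))\<^sup>2) + (LINT p|M. (cmod (W (F - G) p))\<^sup>2)
        = 2 * (LINT p|M. (cmod (W F p))\<^sup>2) + 2 * (LINT p|M. (cmod (W G p))\<^sup>2)"
      by (simp only: Bochner_Integration.integral_add int integrable_mult_right integral_mult_right_zero)
    moreover have "(a - p) + (b - q) = 2 * (c - r) + 2 * (d - s)"
      if "a + b = 2 * c + 2 * d" "p + q = 2 * r + 2 * s" for a b c d p q r s :: real
      using that by simp
    ultimately show ?thesis unfolding D_def using parallelogram_law[of F G] by blast
  qed
  have "D F \<le> 0" for F
  proof -
    obtain s where s: "\<And>n. s n \<in> span E" "s \<longlonglongrightarrow> F" using seq[of F] by blast
    \<comment> \<open>The parallelogram law for \<open>s n\<close> and \<open>F - s n\<close>; the sum of these two vectors is \<open>F\<close>.\<close>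
    have "D F \<le> 2 * (norm (F - s n))\<^sup>2" for n
      using D_parallelogram[of "s n" "F - s n"] D_span[OF s(1), of n] D_le[of "F - s n"]
        D_nonneg[of "s n - (F - s n)"] by simp
    moreover have lim: "(\<lambda>n. 2 * (norm (F - s n))\<^sup>2) \<longlonglongrightarrow> 2 * (norm (F - F))\<^sup>2"
      by (intro tendsto_intros s)
    ultimately have "D F \<le> 2 * (norm (F - F))\<^sup>2"
      by (intro LIMSEQ_le_const[OF lim]) blast
    then show ?thesis by simp
  qed
  then show "(LINT p|M. (cmod (W F p))\<^sup>2) = (norm F)\<^sup>2"
    using D_nonneg[of F] by (simp add: D_def antisym)
qed

lemma L2_inner_of_isometric:
  fixes k :: "'x \<Rightarrow> 't::complex_hilbert"
  defines "W \<equiv> \<lambda>F p. cinner F (k p)"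
  assumes L2: "\<And>F. in_L2 M (W F)" and iso: "\<And>F. (LINT p|M. (cmod (W F p))\<^sup>2) = (norm F)\<^sup>2"
  shows "L2_inner M (W F) (W G) = cinner F G"
proof -
  have int: "integrable M (\<lambda>p. complex_of_real ((cmod (W F p))\<^sup>2))" for F
    using L2 by (intro integrable_of_real) (simp add: in_L2_def)
  have lint: "(LINT p|M. complex_of_real ((cmod (W F p))\<^sup>2)) = complex_of_real ((norm F)\<^sup>2)" for F
    by (simp only: integral_complex_of_real iso)
  have "W F p * cnj (W G p) = (complex_of_real ((cmod (W (F + G) p))\<^sup>2)
     - complex_of_real ((cmod (W (F - G) p))\<^sup>2)
     + \<i> * complex_of_real ((cmod (W (F + scaleC \<i> G) p))\<^sup>2)
     - \<i> * complex_of_real ((cmod (W (F - scaleC \<i> G) p))\<^sup>2)) / 4" for p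
    unfolding complex_polarization[of "W F p" "W G p"]
    by (simp add: W_def cinner.add_left cinner.diff_left cinner_scaleC_left)
  then have "L2_inner M (W F) (W G) = (complex_of_real ((norm (F + G))\<^sup>2) - complex_of_real ((norm (F - G))\<^sup>2)
     + \<i> * complex_of_real ((norm (F + scaleC \<i> G))\<^sup>2)
     - \<i> * complex_of_real ((norm (F - scaleC \<i> G))\<^sup>2)) / 4"
    unfolding L2_inner_def by (simp only: Bochner_Integration.integral_add Bochner_Integration.integral_diff
      integral_mult_right_zero integral_divide_zero lint int integrable_mult_right
      Bochner_Integration.integrable_add Bochner_Integration.integrable_diff)
  then show ?thesis unfolding cinner_polarization[of F G] .
qed

section \<open>Irreducibility of the tensor product\<close>

lemma duflo_moore_operatorD:
  assumes "duflo_moore_operator \<mu> \<pi> C" "g \<in> duflo_moore_domain \<mu> \<pi>"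
  shows "in_L2 \<mu> (wavelet_transform \<pi> g f)"
    and "g' \<in> duflo_moore_domain \<mu> \<pi> \<Longrightarrow>
      L2_inner \<mu> (wavelet_transform \<pi> g f) (wavelet_transform \<pi> g' f') =
      cinner f f' * cnj (cinner (C g) (C g'))"
  using assms unfolding duflo_moore_operator_def Let_def by blast+

lemma admissible_isometry:
  assumes "admissible \<mu> \<pi> g"
  shows "in_L2 \<mu> (wavelet_transform \<pi> g f)"
    and "L2_inner \<mu> (wavelet_transform \<pi> g f) (wavelet_transform \<pi> g f') = cinner f f'"
proof -
  obtain C where C: "duflo_moore_operator \<mu> \<pi> C" "norm (C g) = 1"
    using assms by (auto simp: admissible_def)
  have g: "g \<in> duflo_moore_domain \<mu> \<pi>"
    using assms by (simp add: admissible_def duflo_moore_domain_def)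
  show "in_L2 \<mu> (wavelet_transform \<pi> g f)" by (rule duflo_moore_operatorD(1)[OF C(1) g])
  show "L2_inner \<mu> (wavelet_transform \<pi> g f) (wavelet_transform \<pi> g f') = cinner f f'"
    using duflo_moore_operatorD(2)[OF C(1) g g, of f f'] by (simp add: cinner_self C(2))
qed

text \<open>
Moving \<open>A\<close> across the inner product turns the wavelet transform of \<open>A u\<close> with window \<open>g\<close> into that
of \<open>u\<close> with window \<open>B g\<close>. In particular \<open>B g\<close> is again square integrable (or zero), and the orthogonality
relations for the windows \<open>B g\<close> and \<open>g\<close> give \<open>cinner (A u) w = c * cinner u w\<close>.
\<close>

lemma Schur_of_admissible:
  fixes A B :: "'h::complex_hilbert \<Rightarrow> 'h"
  assumes \<pi>: "unitary_rep \<pi>" and adm: "admissible \<mu> \<pi> g"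
    and adjoint: "\<And>u w. cinner (A u) w = cinner u (B w)"
    and commute: "\<And>x u. A (\<pi> x u) = \<pi> x (A u)"
  shows "\<exists>c. \<forall>u. A u = scaleC c u"
proof -
  obtain C where C: "duflo_moore_operator \<mu> \<pi> C" using adm by (auto simp: admissible_def)
  have g: "g \<in> duflo_moore_domain \<mu> \<pi>"
    using adm by (simp add: admissible_def duflo_moore_domain_def)
  have transfer: "wavelet_transform \<pi> g (A u) = wavelet_transform \<pi> (B g) u" for u
  proof
    fix x
    have "cinner (A u) (\<pi> x g) = cinner (\<pi> (- x) (A u)) g"
      by (simp add: unitary_repD(4)[OF \<pi>])
    also have "\<dots> = cinner (\<pi> (- x) u) (B g)" by (simp only: commute[symmetric] adjoint)
    also have "\<dots> = cinner u (\<pi> x (B g))" by (simp add: unitary_repD(4)[OF \<pi>])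
    finally show "wavelet_transform \<pi> g (A u) x = wavelet_transform \<pi> (B g) u x"
      by (simp add: wavelet_transform_def)
  qed
  have Bg: "B g \<in> duflo_moore_domain \<mu> \<pi>"
    using duflo_moore_operatorD(1)[OF C g, of "A (B g)"]
    by (simp add: duflo_moore_domain_def square_integrable_vector_def transfer)
  define c where "c = cnj (cinner (C (B g)) (C g))"
  have "A u = scaleC c u" for u
  proof (rule cinner_eqI)
    fix w
    have "cinner (A u) w = L2_inner \<mu> (wavelet_transform \<pi> g (A u)) (wavelet_transform \<pi> g w)"
      by (simp add: admissible_isometry(2)[OF adm])
    also have "\<dots> = cinner (scaleC c u) w"
      unfolding transfer duflo_moore_operatorD(2)[OF C Bg g] by (simp add: c_def cinner_scaleC_left)
    finally show "cinner (A u) w = cinner (scaleC c u) w" .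
  qed
  then show ?thesis by blast
qed

context tensor_model
begin

text \<open>
Interchanging the factors makes the statements below about the left factor available for the right
one.
\<close>

lemma swap: "tensor_model (\<lambda>v u. ten u v)"
proof
  have "{ten u v | v u. True} = {ten u v | u v. True}" by auto
  then show "hilbert_tensor (\<lambda>v u. ten u v)"
    using hilbert_tensor unfolding hilbert_tensor_def by (simp add: mult.commute)
qed

text \<open>
The partial inner product of \<open>F\<close> against \<open>v\<close> in the second factor, obtained from Riesz' theorem.
\<close>

lemma slice: "\<exists>s. \<forall>u. cinner (ten u v) F = cinner u s"
proof -
  have "cmod (cinner (ten u v) F) \<le> norm u * (norm v * norm F)" for u
    using cinner_Cauchy_Schwarz[of "ten u v" F] by (simp add: norm_ten mult_ac)
  then obtain s where "\<And>u. cinner (ten u v) F = cinner u s"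
    using Riesz_representation[of "\<lambda>u. cinner (ten u v) F"]
    by (auto simp: ten_add_left ten_scaleC_left cinner_add_left cinner_scaleC_left)
  then show ?thesis by blast
qed

text \<open>
With \<open>v\<close> and \<open>v'\<close> fixed, a self-adjoint \<open>P\<close> that commutes with the action on the left factor
compresses to an operator on that factor which commutes with the representation, so Schur's lemma
applies to it. The operator and its adjoint are slices of \<open>P (ten u v)\<close> and \<open>P (ten w v')\<close>.
\<close>

lemma commuting_form_scalar:
  assumes \<pi>: "unitary_rep \<pi>" and adm: "admissible \<mu> \<pi> g"
    and P: "\<And>F G. cinner (P F) G = cinner F (P G)"
    and T_ten: "\<And>x u v. T x (ten u v) = ten (\<pi> x u) v"
    and T_adj: "\<And>x F G. cinner (T x F) G = cinner F (T (- x) G)"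
    and commute: "\<And>x F. P (T x F) = T x (P F)"
  shows "\<exists>c. \<forall>u u'. cinner (P (ten u v)) (ten u' v') = c * cinner u u'"
proof -
  have "\<forall>u. \<exists>a. \<forall>w. cinner (ten w v') (P (ten u v)) = cinner w a" using slice by blast
  then obtain A where A: "\<And>u w. cinner (ten w v') (P (ten u v)) = cinner w (A u)" by metis
  have "\<forall>w. \<exists>b. \<forall>u. cinner (ten u v) (P (ten w v')) = cinner u b" using slice by blast
  then obtain B where B: "\<And>u w. cinner (ten u v) (P (ten w v')) = cinner u (B w)" by metis
  have A': "cinner (A u) w = cinner (P (ten u v)) (ten w v')" for u w
    using A[of w u] by (metis cinner_commute)
  have "\<exists>c. \<forall>u. A u = scaleC c u"
  proof (rule Schur_of_admissible[OF \<pi> adm])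
    show "cinner (A u) w = cinner u (B w)" for u w by (simp only: A' B[symmetric] P)
    show "A (\<pi> x u) = \<pi> x (A u)" for x u
    proof (rule cinner_eqI)
      fix w
      show "cinner (A (\<pi> x u)) w = cinner (\<pi> x (A u)) w"
        by (simp only: A' unitary_repD(4)[OF \<pi>] T_ten[symmetric] commute T_adj)
    qed
  qed
  then show ?thesis by (metis A' cinner_scaleC_left)
qed

text \<open>
The orthogonal projection \<open>P\<close> onto a closed invariant subspace commutes with the representation. By
\<open>commuting_form_scalar\<close> for either factor, the inner product of \<open>P (ten u v)\<close> with \<open>ten u' v'\<close> is
proportional to \<open>cinner u u'\<close> when \<open>v, v'\<close> are fixed and to \<open>cinner v v'\<close> when \<open>u, u'\<close> are fixed,
hence it is a constant multiple of their product. So \<open>P\<close> is a scalar, and its range is zero or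
everything.
\<close>

lemma irreducible_rep_tensor_rep:
  assumes \<pi>: "unitary_rep \<pi>" and \<rho>: "unitary_rep \<rho>"
    and g: "admissible \<mu> \<pi> g" and h: "admissible \<nu> \<rho> h"
  shows "irreducible_rep (tensor_rep ten \<pi> \<rho>)"
  unfolding irreducible_rep_def
proof (intro allI impI, elim conjE)
  fix S :: "'t set"
  let ?T = "tensor_rep ten \<pi> \<rho>"
  assume S: "complex_subspace S" "closed S" and inv: "\<forall>p. ?T p ` S \<subseteq> S"
  note rep = unitary_rep_tensor_rep[OF \<pi> \<rho>]
  have sub: "subspace S" using S(1) by (simp add: complex_subspace_def)
  have "\<forall>F. \<exists>p\<in>S. \<forall>y\<in>S. cinner (F - p) y = 0" using projection_exists[OF S] by metis
  then obtain P where P: "\<And>F. P F \<in> S" "\<And>F y. y \<in> S \<Longrightarrow> cinner (F - P F) y = 0" by metis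
  have P_unique: "q = P F" if "q \<in> S" "\<And>y. y \<in> S \<Longrightarrow> cinner (F - q) y = 0" for F q
  proof -
    have d: "q - P F \<in> S" using that(1) P(1) sub by (simp add: subspace_diff)
    have "cinner (q - P F) (q - P F) = cinner (F - P F) (q - P F) - cinner (F - q) (q - P F)"
      by (simp add: cinner.diff_left)
    also have "\<dots> = 0" by (simp only: P(2)[OF d] that(2)[OF d] diff_self)
    finally show ?thesis by (simp add: cinner_self)
  qed
  have "cinner (P F) G = cinner (P F) (P G) \<and> cinner F (P G) = cinner (P F) (P G)" for F G
  proof
    have "cinner (G - P G) (P F) = 0" by (rule P(2)[OF P(1)])
    then have "cinner (P F) (G - P G) = 0" by (metis cinner_commute complex_cnj_zero)
    then show "cinner (P F) G = cinner (P F) (P G)" by (simp add: cinner.diff_right)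
    show "cinner F (P G) = cinner (P F) (P G)"
      using P(2)[OF P(1), of F G] by (simp add: cinner.diff_left)
  qed
  then have P_adj: "cinner (P F) G = cinner F (P G)" for F G by metis
  have P_commute: "P (?T p F) = ?T p (P F)" for p F
  proof (rule P_unique[symmetric])
    show "?T p (P F) \<in> S" using inv P(1) by blast
    fix y assume "y \<in> S"
    then have "?T (- p) y \<in> S" using inv by blast
    moreover have "?T p F - ?T p (P F) = ?T p (F - P F)"
      using linear_simps(2)[OF unitary_op_bounded_linear[OF unitary_repD(1)[OF rep]]] by metis
    ultimately show "cinner (?T p F - ?T p (P F)) y = 0"
      by (simp add: unitary_repD(4)[OF rep] P(2))
  qed
  have T_adj: "cinner (?T p F) G = cinner F (?T (- p) G)" for p F G
    by (rule unitary_repD(4)[OF rep])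
  have "\<exists>c. \<forall>u u'. cinner (P (ten u v)) (ten u' v') = c * cinner u u'" for v v'
    by (rule commuting_form_scalar[OF \<pi> g, where T = "\<lambda>x. ?T (x, 0)"])
       (simp_all add: P_adj P_commute T_adj tensor_rep_ten[OF \<pi> \<rho>] unitary_repD(3)[OF \<rho>])
  then obtain c where c: "\<And>v v' u u'. cinner (P (ten u v)) (ten u' v') = c v v' * cinner u u'"
    by metis
  have "\<exists>d. \<forall>v v'. cinner (P (ten u v)) (ten u' v') = d * cinner v v'" for u u'
    by (rule tensor_model.commuting_form_scalar[OF swap \<rho> h, where T = "\<lambda>y. ?T (0, y)"])
       (simp_all add: P_adj P_commute T_adj tensor_rep_ten[OF \<pi> \<rho>] unitary_repD(3)[OF \<pi>])
  then obtain d where d: "\<And>u u' v v'. cinner (P (ten u v)) (ten u' v') = d u u' * cinner v v'"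
    by metis
  have g0: "cinner g g \<noteq> 0"
    using g by (simp add: admissible_def square_integrable_vector_def cinner_self)
  define l where "l = d g g / cinner g g"
  have c_eq: "c v v' = l * cinner v v'" for v v'
    using c[of g v g v'] d[of g v g v'] g0 by (simp add: l_def field_simps)
  have P_ten: "P (ten u v) = scaleC l (ten u v)" for u v
    by (rule cinner_eqI_ten) (simp add: c c_eq cinner_scaleC_left cinner_ten)
  have P_scalar: "P F = scaleC (cnj l) F" for F
    by (rule cinner_eqI_ten) (simp add: P_adj P_ten cinner_scaleC_left cinner_scaleC_right)
  show "S = {0} \<or> S = UNIV"
  proof (rule disjCI)
    assume "S \<noteq> UNIV"
    then obtain F where F: "F \<notin> S" by blast
    have "G = 0" if "G \<in> S" for G
    proof (rule ccontr)
      assume "G \<noteq> 0"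
      have "G = P G" using that by (intro P_unique) (auto simp: cinner.zero_left)
      then have "cinner G G = cnj l * cinner G G" by (metis P_scalar cinner_scaleC_left)
      then have "cnj l = 1" using \<open>G \<noteq> 0\<close> by (simp add: cinner_self)
      then have "P F = F" using scaleC_of_real[of 1 F] by (simp add: P_scalar)
      then show False using F P(1)[of F] by simp
    qed
    then show "S = {0}" using subspace_0[OF sub] by blast
  qed
qed

end

section \<open>Reproducing kernel Hilbert spaces of coefficient functions\<close>

text \<open>
Every vector \<open>F\<close> of a Hilbert space defines a function \<open>x \<mapsto> cinner F (k x)\<close>. When the function space
\<open>A\<close> consists of these functions and carries the inner product of the vectors, it is a reproducing
kernel Hilbert space, and \<open>k\<close> determines it completely. Wavelet spaces are of this form with
\<open>k x = \<pi> x g\<close>.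
\<close>

locale coefficient_space =
  fixes A :: "'x function_space" and k :: "'x \<Rightarrow> 't::complex_hilbert"
    and W :: "'t \<Rightarrow> 'x \<Rightarrow> complex"
  defines "W \<equiv> \<lambda>F x. cinner F (k x)"
  assumes funs: "funs A = range W"
    and finner: "finner A (W F) (W G) = cinner F G"
begin

lemma W_zero: "W 0 = (\<lambda>x. 0)"
  and W_add: "W (F + G) = (\<lambda>x. W F x + W G x)"
  and W_diff: "W (F - G) = (\<lambda>x. W F x - W G x)"
  and W_minus: "W (- F) = (\<lambda>x. - W F x)"
  and W_scaleC: "W (scaleC c F) = (\<lambda>x. c * W F x)"
  by (simp_all add: W_def cinner.zero_left cinner.add_left cinner.diff_left cinner.minus_left
      cinner_scaleC_left)

lemma fnorm_W: "fnorm A (W F) = norm F"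
  by (simp add: fnorm_def finner Re_cinner_self)

lemma inj_W: "inj W"
proof (rule injI)
  fix F G assume "W F = W G"
  then have "cinner F z = cinner G z" for z by (metis finner)
  then show "F = G" by (rule cinner_eqI)
qed

lemma mem_funs: "W F \<in> funs A"
  by (simp add: funs)

lemma function_hilbert_space: "function_hilbert_space A"
proof -
  have complete: "\<exists>f\<in>range W. (\<lambda>n. fnorm A (\<lambda>x. s n x - f x)) \<longlonglongrightarrow> 0"
    if s: "\<forall>n. s n \<in> range W"
      and cauchy: "\<forall>e>0. \<exists>N::nat. \<forall>m\<ge>N. \<forall>n\<ge>N. fnorm A (\<lambda>x. s m x - s n x) < e" for s
  proof -
    from s have "\<forall>n. \<exists>F. s n = W F" by blast
    then obtain F where F: "\<And>n. s n = W (F n)" by (rule choice[THEN exE]) blast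
    have fnorm: "fnorm A (\<lambda>x. s n x - W G x) = norm (F n - G)" for n G
      by (simp only: F W_diff[symmetric] fnorm_W)
    have "Cauchy F"
      unfolding Cauchy_iff using cauchy by (simp only: F fnorm[unfolded F])
    then obtain L where L: "F \<longlonglongrightarrow> L" by (auto simp: Cauchy_convergent_iff convergent_def)
    have "(\<lambda>n. norm (F n - L)) \<longlonglongrightarrow> norm (L - L)" by (intro tendsto_intros L)
    then have "(\<lambda>n. fnorm A (\<lambda>x. s n x - W L x)) \<longlonglongrightarrow> 0"
      by (simp add: fnorm)
    then show ?thesis by blast
  qed
  have definite: "F = 0" if "cinner F F = 0" for F :: 't
    using that by (simp add: cinner_self)
  show ?thesis
    unfolding function_hilbert_space_def funs
  proof (intro conjI)
    show "(\<lambda>x. 0) \<in> range W" using W_zero by (metis rangeI)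
    show "\<forall>f\<in>range W. \<forall>g\<in>range W. (\<lambda>x. f x + g x) \<in> range W"
      and "\<forall>f\<in>range W. \<forall>g\<in>range W. \<forall>h\<in>range W.
        finner A (\<lambda>x. f x + g x) h = finner A f h + finner A g h"
      by (simp_all add: finner cinner_add_left flip: W_add)
    show "\<forall>c. \<forall>f\<in>range W. (\<lambda>x. c * f x) \<in> range W"
      and "\<forall>c. \<forall>f\<in>range W. \<forall>g\<in>range W. finner A (\<lambda>x. c * f x) g = c * finner A f g"
      by (simp_all add: finner cinner_scaleC_left flip: W_scaleC)
    show "\<forall>f\<in>range W. \<forall>g\<in>range W. finner A f g = cnj (finner A g f)"
      by (simp add: finner flip: cinner_commute)
    show "\<forall>f\<in>range W. 0 \<le> Re (finner A f f) \<and> (finner A f f = 0 \<longrightarrow> f = (\<lambda>x. 0))"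
      by (auto simp: finner Re_cinner_self W_zero dest!: definite)
  qed (use complete in blast)
qed

lemma rkhs: "rkhs A"
  unfolding rkhs_def
proof (intro conjI function_hilbert_space allI)
  fix x
  have "cmod (W F x) \<le> norm (k x) * fnorm A (W F)" for F
    using cinner_Cauchy_Schwarz[of F "k x"] unfolding fnorm_W by (simp add: W_def mult.commute)
  then show "\<exists>B. \<forall>f\<in>funs A. cmod (f x) \<le> B * fnorm A f" by (auto simp: funs)
qed

lemma kernel_element_eq: "kernel_element A x = W (k x)"
  unfolding kernel_element_def
proof (rule the_equality)
  show "W (k x) \<in> funs A \<and> (\<forall>f\<in>funs A. f x = finner A f (W (k x)))"
    by (auto simp: funs finner) (simp add: W_def)
  fix f assume f: "f \<in> funs A \<and> (\<forall>f'\<in>funs A. f' x = finner A f' f)"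
  then obtain F where F: "f = W F" by (auto simp: funs)
  have "cinner G (k x) = cinner G F" for G
    using f mem_funs[of G] unfolding F by (metis finner W_def)
  then have "F = k x" by (metis cinner_commute cinner_eqI)
  then show "f = W (k x)" by (simp add: F)
qed

lemma reproducing_kernel_eq: "reproducing_kernel A x y = cinner (k y) (k x)"
  by (simp add: reproducing_kernel_def kernel_element_eq finner)

end

text \<open>
It therefore suffices to exhibit both sides of the proposition as coefficient spaces of one family
of vectors.
\<close>

lemma rkhs_isomorphic_coefficient_spaces:
  assumes "coefficient_space A k" "coefficient_space B k"
  shows "rkhs_isomorphic A B"
proof -
  interpret A: coefficient_space A k "\<lambda>F x. cinner F (k x)" by fact
  interpret B: coefficient_space B k "\<lambda>F x. cinner F (k x)" by fact
  show ?thesis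
    unfolding rkhs_isomorphic_def
    by (auto simp: A.rkhs B.rkhs A.funs B.funs A.finner B.finner fun_eq_iff
        A.reproducing_kernel_eq B.reproducing_kernel_eq)
qed

locale coefficient_tensor =
  A: coefficient_space A k1 W1 + B: coefficient_space B k2 W2 + tensor_model ten
  for A :: "'x function_space" and k1 :: "'x \<Rightarrow> 'h::complex_hilbert" and W1
    and B :: "'y function_space" and k2 :: "'y \<Rightarrow> 'k::complex_hilbert" and W2
    and ten :: "'h \<Rightarrow> 'k \<Rightarrow> 't::complex_hilbert"
begin

text \<open>
The element of the Hilbert space tensor product that corresponds to a formal sum of tensors of
functions, through the identifications \<open>W1\<close> and \<open>W2\<close>.
\<close>

definition tensor_vec :: "('x, 'y) alg_tensor \<Rightarrow> 't" where
  "tensor_vec s = (\<Sum>(f, g)\<leftarrow>s. ten (inv W1 f) (inv W2 g))"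

definition tensor_coefficient :: "'t \<Rightarrow> 'x \<times> 'y \<Rightarrow> complex" where
  "tensor_coefficient F = (\<lambda>p. cinner F (ten (k1 (fst p)) (k2 (snd p))))"

lemma inv_W: "inv W1 (W1 u) = u" "inv W2 (W2 v) = v"
  by (simp_all add: A.inj_W B.inj_W)

lemma tensor_vec_simps:
  "tensor_vec [] = 0"
  "tensor_vec ((W1 u, W2 v) # s) = ten u v + tensor_vec s"
  "tensor_vec (s @ t) = tensor_vec s + tensor_vec t"
  by (simp_all add: tensor_vec_def inv_W)

lemma funs_pairs_induct [consumes 1, case_names Nil Cons]:
  assumes "set s \<subseteq> funs A \<times> funs B" "Q []"
    "\<And>u v s. set s \<subseteq> funs A \<times> funs B \<Longrightarrow> Q s \<Longrightarrow> Q ((W1 u, W2 v) # s)"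
  shows "Q s"
  using assms(1)
proof (induction s)
  case (Cons p s)
  obtain u v where "p = (W1 u, W2 v)" using Cons.prems by (auto simp: A.funs B.funs)
  then show ?case using Cons assms(3) by auto
qed (rule assms(2))

lemma alg_tensor_inner_eq:
  assumes "set s \<subseteq> funs A \<times> funs B" "set t \<subseteq> funs A \<times> funs B"
  shows "alg_tensor_inner A B s t = cinner (tensor_vec s) (tensor_vec t)"
  using assms(1)
proof (induction rule: funs_pairs_induct)
  case Nil
  then show ?case by (simp add: alg_tensor_inner_def tensor_vec_simps cinner.zero_left)
next
  case (Cons u v s)
  have "(\<Sum>(f', g')\<leftarrow>t. finner A (W1 u) f' * finner B (W2 v) g') = cinner (ten u v) (tensor_vec t)"
    using assms(2)
    by (induction rule: funs_pairs_induct)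
       (simp_all add: tensor_vec_simps cinner.zero_right cinner.add_right cinner_ten A.finner B.finner)
  then show ?case using Cons by (simp add: alg_tensor_inner_def tensor_vec_simps cinner.add_left)
qed

lemma tensor_vec_diff:
  assumes "set s \<subseteq> funs A \<times> funs B" "set t \<subseteq> funs A \<times> funs B"
  shows "set (alg_tensor_diff s t) \<subseteq> funs A \<times> funs B" "tensor_vec (alg_tensor_diff s t) = tensor_vec s - tensor_vec t"
proof -
  have "set (map (\<lambda>(f, g). (\<lambda>x. - f x, g)) t) \<subseteq> funs A \<times> funs B \<and>
      tensor_vec (map (\<lambda>(f, g). (\<lambda>x. - f x, g)) t) = - tensor_vec t"
    using assms(2)
  proof (induction rule: funs_pairs_induct)
    case (Cons u v s)
    have "ten (- u) v = - ten u v"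
      using ten_scaleC_left[of "-1" u v] by (simp add: scaleC_minus_one)
    then show ?case
      using Cons A.mem_funs B.mem_funs by (simp add: tensor_vec_simps flip: A.W_minus)
  qed (simp add: tensor_vec_simps)
  with assms(1) show "set (alg_tensor_diff s t) \<subseteq> funs A \<times> funs B"
    "tensor_vec (alg_tensor_diff s t) = tensor_vec s - tensor_vec t"
    by (auto simp: alg_tensor_diff_def tensor_vec_simps)
qed

lemma alg_tensor_fun_eq:
  assumes "set s \<subseteq> funs A \<times> funs B"
  shows "alg_tensor_fun s = tensor_coefficient (tensor_vec s)"
proof
  fix p
  have W: "W1 u x = cinner u (k1 x)" "W2 v y = cinner v (k2 y)" for u v x y
    by (simp_all add: A.W_def B.W_def)
  show "alg_tensor_fun s p = tensor_coefficient (tensor_vec s) p"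
    using assms
    by (induction rule: funs_pairs_induct)
       (simp_all add: alg_tensor_fun_def tensor_coefficient_def split_beta tensor_vec_simps cinner.zero_left
         cinner.add_left cinner_ten W)
qed

lemma tensor_vec_range:
  assumes "z \<in> span elementary"
  shows "\<exists>s. set s \<subseteq> funs A \<times> funs B \<and> tensor_vec s = z"
  using assms
proof (induction rule: span_induct_alt)
  case base
  show ?case by (rule exI[of _ "[]"]) (simp add: tensor_vec_simps)
next
  case (step r x y)
  then obtain s u v where s: "set s \<subseteq> funs A \<times> funs B" "tensor_vec s = y" and x: "x = ten u v"
    by (auto simp: elementary_def)
  have "ten (scaleC (complex_of_real r) u) v = r *\<^sub>R x"
    by (simp only: x ten_scaleC_left) (simp only: scaleC_of_real)
  with s A.mem_funs B.mem_funs show ?case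
    by (intro exI[of _ "(W1 (scaleC (complex_of_real r) u), W2 v) # s"]) (simp add: tensor_vec_simps)
qed

text \<open>
Formal sums have the inner products of the corresponding vectors, so a Cauchy sequence of formal
sums is the same as a convergent sequence of vectors, and its pointwise limit is the coefficient
function of the limit vector.
\<close>

lemma represents_iff:
  "represents A B s F \<longleftrightarrow>
     (\<forall>n. set (s n) \<subseteq> funs A \<times> funs B) \<and> (\<exists>V. (\<lambda>n. tensor_vec (s n)) \<longlonglongrightarrow> V \<and> F = tensor_coefficient V)"
proof (cases "\<forall>n. set (s n) \<subseteq> funs A \<times> funs B")
  case True
  have norm: "sqrt (Re (alg_tensor_inner A B (alg_tensor_diff (s m) (s n)) (alg_tensor_diff (s m) (s n))))
      = norm (tensor_vec (s m) - tensor_vec (s n))" for m n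
    using True by (simp add: alg_tensor_inner_eq tensor_vec_diff Re_cinner_self)
  have lim: "(\<lambda>n. alg_tensor_fun (s n) p) \<longlonglongrightarrow> tensor_coefficient V p" if "(\<lambda>n. tensor_vec (s n)) \<longlonglongrightarrow> V" for V p
    using True that by (simp add: alg_tensor_fun_eq tensor_coefficient_def cinner.tendsto)
  have "represents A B s F \<longleftrightarrow>
      Cauchy (\<lambda>n. tensor_vec (s n)) \<and> (\<forall>p. (\<lambda>n. alg_tensor_fun (s n) p) \<longlonglongrightarrow> F p)"
    unfolding represents_def norm using True by (simp add: Cauchy_iff)
  also have "\<dots> \<longleftrightarrow> (\<exists>V. (\<lambda>n. tensor_vec (s n)) \<longlonglongrightarrow> V \<and> F = tensor_coefficient V)"
  proof
    assume *: "Cauchy (\<lambda>n. tensor_vec (s n)) \<and> (\<forall>p. (\<lambda>n. alg_tensor_fun (s n) p) \<longlonglongrightarrow> F p)"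
    then obtain V where V: "(\<lambda>n. tensor_vec (s n)) \<longlonglongrightarrow> V" by (auto simp: Cauchy_convergent_iff convergent_def)
    have "F p = tensor_coefficient V p" for p using * lim[OF V] LIMSEQ_unique by blast
    then show "\<exists>V. (\<lambda>n. tensor_vec (s n)) \<longlonglongrightarrow> V \<and> F = tensor_coefficient V" using V by blast
  next
    assume "\<exists>V. (\<lambda>n. tensor_vec (s n)) \<longlonglongrightarrow> V \<and> F = tensor_coefficient V"
    then show "Cauchy (\<lambda>n. tensor_vec (s n)) \<and> (\<forall>p. (\<lambda>n. alg_tensor_fun (s n) p) \<longlonglongrightarrow> F p)"
      using lim LIMSEQ_imp_Cauchy by blast
  qed
  finally show ?thesis using True by simp
qed (auto simp: represents_def)

lemma represents_exists: "\<exists>s. represents A B s (tensor_coefficient V)"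
proof -
  obtain z where z: "\<And>n. z n \<in> span elementary" "z \<longlonglongrightarrow> V"
    using elementary_dense by (metis UNIV_I closure_sequential)
  obtain s where "\<And>n. set (s n) \<subseteq> funs A \<times> funs B" "\<And>n. tensor_vec (s n) = z n"
    using tensor_vec_range[OF z(1)] by metis
  then have "represents A B s (tensor_coefficient V)" using z(2) by (auto simp: represents_iff)
  then show ?thesis by blast
qed

text \<open>
A vector orthogonal to all \<open>ten (k1 x) (k2 y)\<close> vanishes: slicing it first along \<open>k2 y\<close> and then
along an arbitrary \<open>u\<close> leads to vectors of the factors whose coefficient functions are zero.
\<close>

lemma inj_tensor_coefficient: "inj tensor_coefficient"
proof (rule injI)
  fix F G assume eq: "tensor_coefficient F = tensor_coefficient G"
  have eq': "cinner F (ten (k1 x) (k2 y)) = cinner G (ten (k1 x) (k2 y))" for x y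
    using fun_cong[OF eq, of "(x, y)"] by (simp add: tensor_coefficient_def)
  have 0: "cinner (ten (k1 x) (k2 y)) (F - G) = 0" for x y
    using eq'[of x y] by (metis cinner.diff_left cinner_commute complex_cnj_zero right_minus_eq)
  have 1: "cinner (ten u (k2 y)) (F - G) = 0" for u y
  proof -
    obtain s where s: "\<And>u. cinner (ten u (k2 y)) (F - G) = cinner u s" using slice by metis
    have "W1 s = W1 0"
      using s 0 by (auto simp: A.W_def cinner.zero_left fun_eq_iff) (metis cinner_commute complex_cnj_zero)
    then have "s = 0" using A.inj_W by (simp add: inj_eq)
    then show ?thesis by (simp add: s cinner.zero_right)
  qed
  have "cinner (ten u v) (F - G) = 0" for u v
  proof -
    obtain s where s: "\<And>v. cinner (ten u v) (F - G) = cinner v s"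
      using tensor_model.slice[OF swap] by metis
    have "W2 s = W2 0"
      using s 1 by (auto simp: B.W_def cinner.zero_left fun_eq_iff) (metis cinner_commute complex_cnj_zero)
    then have "s = 0" using B.inj_W by (simp add: inj_eq)
    then show ?thesis by (simp add: s cinner.zero_right)
  qed
  then have "F - G = 0"
    by (intro cinner_eqI_ten) (metis cinner.zero_left cinner_commute complex_cnj_zero)
  then show "F = G" by simp
qed

text \<open>
Representing sequences exist for every coefficient function and converge to a vector that the
function determines; hence the limit in the definition of the inner product exists and is unique.
\<close>

lemma coefficient_space_rkhs_tensor:
  "coefficient_space (rkhs_tensor A B) (\<lambda>p. ten (k1 (fst p)) (k2 (snd p)))"
proof
  have "represents A B s F \<Longrightarrow> F \<in> range tensor_coefficient" for s F by (auto simp: represents_iff)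
  then have "funs (rkhs_tensor A B) = range tensor_coefficient"
    using represents_exists by (auto simp: rkhs_tensor_def)
  then show "funs (rkhs_tensor A B) = range (\<lambda>F p. cinner F (ten (k1 (fst p)) (k2 (snd p))))"
    by (simp add: tensor_coefficient_def[abs_def])
next
  fix F G
  have lim: "(\<lambda>n. alg_tensor_inner A B (s n) (t n)) \<longlonglongrightarrow> cinner F G"
    if "represents A B s (tensor_coefficient F)" "represents A B t (tensor_coefficient G)" for s t
  proof -
    have "(\<lambda>n. tensor_vec (s n)) \<longlonglongrightarrow> F" "(\<lambda>n. tensor_vec (t n)) \<longlonglongrightarrow> G"
      using that inj_tensor_coefficient by (auto simp: represents_iff inj_eq)
    moreover have "\<And>n. set (s n) \<subseteq> funs A \<times> funs B" "\<And>n. set (t n) \<subseteq> funs A \<times> funs B"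
      using that by (auto simp: represents_iff)
    ultimately show ?thesis by (simp add: alg_tensor_inner_eq cinner.tendsto)
  qed
  have "finner (rkhs_tensor A B) (tensor_coefficient F) (tensor_coefficient G) = cinner F G"
    unfolding rkhs_tensor_def function_space.simps
  proof (rule the_equality)
    show "\<forall>s t. represents A B s (tensor_coefficient F) \<longrightarrow> represents A B t (tensor_coefficient G) \<longrightarrow>
        (\<lambda>n. alg_tensor_inner A B (s n) (t n)) \<longlonglongrightarrow> cinner F G"
      using lim by blast
    show "c = cinner F G"
      if "\<forall>s t. represents A B s (tensor_coefficient F) \<longrightarrow> represents A B t (tensor_coefficient G) \<longrightarrow>
        (\<lambda>n. alg_tensor_inner A B (s n) (t n)) \<longlonglongrightarrow> c" for c
      using that lim represents_exists[of F] represents_exists[of G] LIMSEQ_unique by blast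
  qed
  then show "finner (rkhs_tensor A B) (\<lambda>p. cinner F (ten (k1 (fst p)) (k2 (snd p))))
      (\<lambda>p. cinner G (ten (k1 (fst p)) (k2 (snd p)))) = cinner F G"
    by (simp add: tensor_coefficient_def)
qed

end

section \<open>The wavelet space of a tensor product\<close>

lemma coefficient_space_wavelet_space:
  assumes "\<And>F G. L2_inner \<mu> (wavelet_transform \<pi> g F) (wavelet_transform \<pi> g G) = cinner F G"
  shows "coefficient_space (wavelet_space \<mu> \<pi> g) (\<lambda>x. \<pi> x g)"
  using assms by unfold_locales (simp_all add: wavelet_space_def wavelet_transform_def)

theorem proposition1p4:
  fixes \<mu> :: "'a::{topological_group_add,t2_space} measure"
    and \<nu> :: "'b::{topological_group_add,t2_space} measure"
    and \<kappa> :: "('a \<times> 'b) measure"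
    and \<pi> :: "'a \<Rightarrow> 'h::complex_hilbert \<Rightarrow> 'h"
    and \<rho> :: "'b \<Rightarrow> 'k::complex_hilbert \<Rightarrow> 'k"
    and ten :: "'h \<Rightarrow> 'k \<Rightarrow> 't::complex_hilbert"
    and g :: 'h and h :: 'k
  assumes "locally_compact_space (euclidean :: 'a topology)"
    and "locally_compact_space (euclidean :: 'b topology)"
    and "left_haar_measure \<mu>" and "left_haar_measure \<nu>"
    and "radon_product_measure \<mu> \<nu> \<kappa>"
    and "square_integrable_rep \<mu> \<pi>" and "square_integrable_rep \<nu> \<rho>"
    and "admissible \<mu> \<pi> g" and "admissible \<nu> \<rho> h"
    and "hilbert_tensor ten"
  shows
    "square_integrable_rep \<kappa> (tensor_rep ten \<pi> \<rho>) \<and>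
     (\<forall>F. in_L2 \<kappa> (wavelet_transform (tensor_rep ten \<pi> \<rho>) (ten g h) F) \<and>
          (LINT p|\<kappa>. (cmod (wavelet_transform (tensor_rep ten \<pi> \<rho>) (ten g h) F p))\<^sup>2) = (norm F)\<^sup>2) \<and>
     rkhs_isomorphic
       (wavelet_space \<kappa> (tensor_rep ten \<pi> \<rho>) (ten g h))
       (rkhs_tensor (wavelet_space \<mu> \<pi> g) (wavelet_space \<nu> \<rho> h))"
proof -
  interpret tensor_model ten by (unfold_locales) fact
  let ?T = "tensor_rep ten \<pi> \<rho>"
  let ?W = "wavelet_transform ?T (ten g h)"
  have \<mu>: "radon_measure \<mu>" and \<nu>: "radon_measure \<nu>"
    using assms(3,4) by (simp_all add: left_haar_measure_def)
  note \<kappa> = assms(5) and g = assms(8) and h = assms(9)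
  have \<pi>: "unitary_rep \<pi>" and \<rho>: "unitary_rep \<rho>"
    using assms(6,7) by (simp_all add: square_integrable_rep_def)
  have rep: "unitary_rep ?T" by (rule unitary_rep_tensor_rep[OF \<pi> \<rho>])
  have meas: "?W F \<in> borel_measurable \<kappa>" for F
    using borel_measurable_continuous_onI[OF unitary_repD(5)[OF rep]]
    by (simp add: measurable_cong_sets[OF sets_radon_product(3)[OF \<mu> \<nu> \<kappa>] refl])
  have "has_bochner_integral \<kappa> (\<lambda>p. ?W e p * cnj (?W e' p)) (cinner e e')"
    if "e \<in> elementary" "e' \<in> elementary" for e e'
  proof -
    obtain u v u' v' where e: "e = ten u v" "e' = ten u' v'" using \<open>e \<in> elementary\<close> \<open>e' \<in> elementary\<close>
      unfolding elementary_def by blast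
    let ?a = "\<lambda>x. wavelet_transform \<pi> g u x * cnj (wavelet_transform \<pi> g u' x)"
    let ?b = "\<lambda>y. wavelet_transform \<rho> h v y * cnj (wavelet_transform \<rho> h v' y)"
    have "has_bochner_integral \<kappa> (\<lambda>p. ?a (fst p) * ?b (snd p)) ((LINT x|\<mu>. ?a x) * (LINT y|\<nu>. ?b y))"
    proof (rule integral_radon_product[OF \<mu> \<nu> \<kappa>])
      show "continuous_on UNIV ?a" "continuous_on UNIV ?b"
        by (intro continuous_on_mult continuous_on_cnj unitary_repD(5) \<pi> \<rho>)+
      show "integrable \<mu> ?a" "integrable \<nu> ?b"
        by (intro integrable_mult_of_in_L2 admissible_isometry(1) g h)+
    qed
    also have "(LINT x|\<mu>. ?a x) * (LINT y|\<nu>. ?b y) = cinner e e'"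
      using admissible_isometry(2)[OF g, of u u'] admissible_isometry(2)[OF h, of v v']
      by (simp add: L2_inner_def e cinner_ten)
    finally show ?thesis
      by (simp add: e wavelet_transform_ten[OF \<pi> \<rho>] mult_ac)
  qed
  note iso = isometric_coefficient_map[OF meas[unfolded wavelet_transform_def] elementary_dense
      this[unfolded wavelet_transform_def]]
  have isometry: "in_L2 \<kappa> (?W F)" "(LINT p|\<kappa>. (cmod (?W F p))\<^sup>2) = (norm F)\<^sup>2" for F
    unfolding wavelet_transform_def using iso by blast+
  have "g \<noteq> 0" "h \<noteq> 0"
    using g h by (simp_all add: admissible_def square_integrable_vector_def)
  then have "ten g h \<noteq> 0" by (metis norm_ten norm_eq_zero mult_eq_0_iff)
  then have "square_integrable_rep \<kappa> ?T"
    using rep irreducible_rep_tensor_rep[OF \<pi> \<rho> g h] isometry(1)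
    by (auto simp: square_integrable_rep_def square_integrable_vector_def)
  moreover have "rkhs_isomorphic (wavelet_space \<kappa> ?T (ten g h))
      (rkhs_tensor (wavelet_space \<mu> \<pi> g) (wavelet_space \<nu> \<rho> h))"
  proof (rule rkhs_isomorphic_coefficient_spaces)
    show "coefficient_space (wavelet_space \<kappa> ?T (ten g h)) (\<lambda>p. ?T p (ten g h))"
      using isometry unfolding wavelet_transform_def
      by (intro coefficient_space_wavelet_space, unfold wavelet_transform_def) (rule L2_inner_of_isometric)
    interpret coefficient_tensor "wavelet_space \<mu> \<pi> g" "\<lambda>x. \<pi> x g" "\<lambda>F x. cinner F (\<pi> x g)"
      "wavelet_space \<nu> \<rho> h" "\<lambda>y. \<rho> y h" "\<lambda>F y. cinner F (\<rho> y h)" ten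
      by (intro coefficient_tensor.intro coefficient_space_wavelet_space admissible_isometry(2) g h
          tensor_model_axioms)
    show "coefficient_space (rkhs_tensor (wavelet_space \<mu> \<pi> g) (wavelet_space \<nu> \<rho> h))
        (\<lambda>p. ?T p (ten g h))"
      using coefficient_space_rkhs_tensor by (simp add: tensor_rep_ten[OF \<pi> \<rho>])
  qed
  ultimately show ?thesis using isometry by blast
qed

end
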